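(* Let $\mathcal{M}$ be an essentially reductive, finite rank, quasi-free Hilbert module over $A(\mathbb{D})$. Let $U$ be an isometric module map on $\mathcal{M}$ such that $\bigcap_{k=0}^{\infty}U^k\mathcal{M}=\{0\}$. Then $\mathcal{M}$ is unitarily equivalent (as an $A(\mathbb{D})$-module) to $H^2_{\mathcal{F}}(\mathbb{D})$ for some Hilbert space $\mathcal{F}$ with $\dim\mathcal{F}=\operatorname{rank}\mathcal{M}$.
   Context: $\mathbb{D}$ is the open unit disk and $A(\mathbb{D})$ is the completion, in the supremum norm over $\mathbb{D}$, of the functions holomorphic on a neighborhood of the closed disk. All Hilbert spaces are complex and separable. A (contractive) Hilbert module over $A(\mathbb{D})$ is a Hilbert space $\mathcal{M}$ which is a unital $A(\mathbb{D})$-module with $\|\varphi f\|_{\mathcal{M}}\le\|\varphi\|_{A(\mathbb{D})}\|f\|_{\mathcal{M}}$. For $\varphi\in A(\mathbb{D})$, $M_\varphi$ is the operator of module multiplication by $\varphi$; the module is essentially reductive if $M_\varphi^*M_\varphi-M_\varphi M_\varphi^*$ is compact for every $\varphi\in A(\mathbb{D})$. Quasi-free: for $1\le m\le\infty$, let $\ell^2_m$ be the Hilbert space of dimension $m$. A Hilbert space $\mathcal{R}$ is a quasi-free Hilbert module of rank $m$ over $A(\mathbb{D})$ if it is the completion of the algebraic tensor product $A(\mathbb{D})\otimes\ell^2_m$ in an inner product such that: (1) for each $z\in\mathbb{D}$ the evaluation map $\mathrm{eval}_{z}:A(\mathbb{D})\otimes\ell^2_m\to\ell^2_m$ is bounded,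 and these maps are locally uniformly bounded on $\mathbb{D}$; (2) $\|\sum\varphi\theta_i\otimes x_i\|_{\mathcal{R}}\le\|\varphi\|_{A(\mathbb{D})}\|\sum\theta_i\otimes x_i\|_{\mathcal{R}}$ for $\varphi,\theta_i\in A(\mathbb{D})$, $x_i\in\ell^2_m$; (3) for every sequence $\{F_i\}$ in $A(\mathbb{D})\otimes\ell^2_m$ which is Cauchy in the $\mathcal{R}$-norm, $\mathrm{eval}_{z}(F_i)\to0$ for all $z\in\mathbb{D}$ if and only if $\|F_i\|_{\mathcal{R}}\to0$. Finite rank means $m<\infty$. $H^2_{\mathcal{F}}(\mathbb{D})$ is the Hardy space of $\mathcal{F}$-valued functions on $\mathbb{D}$, with $A(\mathbb{D})$ acting by pointwise multiplication. Two Hilbert modules are unitarily equivalent if there is a unitary module map between them. *)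

theory Defs
  imports "HOL-Analysis.Analysis"
begin

text \<open>
  Complex Hilbert spaces. The norm and the topology are those of the underlying real inner
  product space, whose inner product is the real part of the complex one (linear in the first
  argument). Separability is left to the sort \<^class>\<open>second_countable_topology\<close>.
\<close>

class complex_hilbert_space = real_inner + complete_space +
  fixes scaleC :: "complex \<Rightarrow> 'a \<Rightarrow> 'a"  (infixr "*\<^sub>C" 75)
    and cinner :: "'a \<Rightarrow> 'a \<Rightarrow> complex"
  assumes scaleC_add_right: "c *\<^sub>C (x + y) = c *\<^sub>C x + c *\<^sub>C y"
    and scaleC_add_left: "(c + d) *\<^sub>C x = c *\<^sub>C x + d *\<^sub>C x"
    and scaleC_scaleC: "c *\<^sub>C d *\<^sub>C x = (c * d) *\<^sub>C x"
    and scaleR_scaleC: "r *\<^sub>R x = complex_of_real r *\<^sub>C x"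
    and cinner_commute: "cinner x y = cnj (cinner y x)"
    and cinner_add_left: "cinner (x + y) z = cinner x z + cinner y z"
    and cinner_scaleC_left: "cinner (c *\<^sub>C x) y = c * cinner x y"
    and inner_Re_cinner: "inner x y = Re (cinner x y)"

global_interpretation complex_vector: vector_space "scaleC :: complex \<Rightarrow> 'a \<Rightarrow> 'a::complex_hilbert_space"
  defines csubspace = complex_vector.subspace
    and cspan = complex_vector.span
    and cdependent = complex_vector.dependent
    and crepresentation = complex_vector.representation
    and cextend_basis = complex_vector.extend_basis
    and cdim = complex_vector.dim
proof
  fix c d :: complex and x y :: 'a
  show "c *\<^sub>C (x + y) = c *\<^sub>C x + c *\<^sub>C y" by (rule scaleC_add_right)
  show "(c + d) *\<^sub>C x = c *\<^sub>C x + d *\<^sub>C x" by (rule scaleC_add_left)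
  show "c *\<^sub>C d *\<^sub>C x = (c * d) *\<^sub>C x" by (rule scaleC_scaleC)
  have "(1::real) *\<^sub>R x = complex_of_real 1 *\<^sub>C x" by (rule scaleR_scaleC)
  then show "1 *\<^sub>C x = x" by simp
qed

abbreviation clinear :: "('a::complex_hilbert_space \<Rightarrow> 'b::complex_hilbert_space) \<Rightarrow> bool" where
  "clinear \<equiv> Vector_Spaces.linear scaleC scaleC"

lemma cinner_eq_inner:
  "cinner x y = Complex (inner x y) (inner x (\<i> *\<^sub>C y))" for x y :: "'a::complex_hilbert_space"
proof -
  have "cinner x (\<i> *\<^sub>C y) = cnj (cinner (\<i> *\<^sub>C y) x)" by (rule cinner_commute)
  also have "\<dots> = cnj (\<i> * cnj (cinner x y))"
    by (simp add: cinner_scaleC_left cinner_commute[of x y])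
  finally have "cinner x (\<i> *\<^sub>C y) = - \<i> * cinner x y" by simp
  then show ?thesis by (simp add: inner_Re_cinner complex_eq_iff)
qed

lemma bounded_linear_cinner_left:
  "bounded_linear (\<lambda>x. cinner x y)" for y :: "'a::complex_hilbert_space"
proof -
  have "(\<lambda>x. cinner x y) = (\<lambda>x. of_real (inner x y) + of_real (inner x (\<i> *\<^sub>C y)) * \<i>)"
    by (simp add: fun_eq_iff cinner_eq_inner complex_eq_iff)
  moreover have "bounded_linear (\<lambda>x. of_real (inner x y) + of_real (inner x (\<i> *\<^sub>C y)) * \<i> :: complex)"
    by (intro bounded_linear_add bounded_linear_mult_const
        bounded_linear_compose[OF bounded_linear_of_real] bounded_linear_inner_left)
  ultimately show ?thesis by simp
qed

instantiation complex :: complex_hilbert_space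
begin

definition scaleC_complex :: "complex \<Rightarrow> complex \<Rightarrow> complex" where
  "scaleC_complex c x = c * x"

definition cinner_complex :: "complex \<Rightarrow> complex \<Rightarrow> complex" where
  "cinner_complex x y = x * cnj y"

instance
  by standard (auto simp: scaleC_complex_def cinner_complex_def algebra_simps scaleR_conv_of_real
      inner_complex_def)

end

instantiation vec :: (complex_hilbert_space, finite) complex_hilbert_space
begin

definition scaleC_vec :: "complex \<Rightarrow> 'a ^ 'b \<Rightarrow> 'a ^ 'b" where
  "scaleC_vec c x = (\<chi> i. c *\<^sub>C x $ i)"

definition cinner_vec :: "'a ^ 'b \<Rightarrow> 'a ^ 'b \<Rightarrow> complex" where
  "cinner_vec x y = (\<Sum>i\<in>UNIV. cinner (x $ i) (y $ i))"

instance
proof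
  fix c d :: complex and r :: real and x y z :: "'a ^ 'b"
  show "c *\<^sub>C (x + y) = c *\<^sub>C x + c *\<^sub>C y"
    by (simp add: scaleC_vec_def vec_eq_iff scaleC_add_right)
  show "(c + d) *\<^sub>C x = c *\<^sub>C x + d *\<^sub>C x"
    by (simp add: scaleC_vec_def vec_eq_iff scaleC_add_left)
  show "c *\<^sub>C d *\<^sub>C x = (c * d) *\<^sub>C x"
    by (simp add: scaleC_vec_def vec_eq_iff)
  show "r *\<^sub>R x = complex_of_real r *\<^sub>C x"
    by (simp add: scaleC_vec_def vec_eq_iff scaleR_scaleC)
  show "cinner x y = cnj (cinner y x)"
    unfolding cinner_vec_def cnj_sum by (rule sum.cong[OF refl]) (rule cinner_commute)
  show "cinner (x + y) z = cinner x z + cinner y z"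
    by (simp add: cinner_vec_def cinner_add_left sum.distrib)
  show "cinner (c *\<^sub>C x) y = c * cinner x y"
    by (simp add: cinner_vec_def scaleC_vec_def cinner_scaleC_left sum_distrib_left)
  show "inner x y = Re (cinner x y)"
    by (simp add: cinner_vec_def inner_vec_def inner_Re_cinner)
qed

end

definition cadjoint :: "('a::complex_hilbert_space \<Rightarrow> 'b::complex_hilbert_space) \<Rightarrow> 'b \<Rightarrow> 'a" where
  "cadjoint T = (SOME S. \<forall>x y. cinner (T x) y = cinner x (S y))"

definition compact_operator :: "('a::complex_hilbert_space \<Rightarrow> 'b::complex_hilbert_space) \<Rightarrow> bool" where
  "compact_operator T \<longleftrightarrow> clinear T \<and> compact (closure (T ` cball 0 1))"

abbreviation unit_disk :: "complex set"  ("\<D>") where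
  "\<D> \<equiv> ball 0 1"

text \<open>
  The completion of the functions holomorphic near the closed disk, in the supremum norm over the
  open disk, is the closure of these functions in the bounded functions on the disk. Functions on
  the disk are represented by total functions vanishing off the disk, so that equality of
  functions is equality on the disk.
\<close>

definition disk_algebra :: "(complex \<Rightarrow> complex) set" where
  "disk_algebra = {\<phi>. (\<forall>z. z \<notin> \<D> \<longrightarrow> \<phi> z = 0) \<and>
     (\<forall>\<epsilon>>0. \<exists>S g. open S \<and> cball 0 1 \<subseteq> S \<and> g holomorphic_on S \<and>
        (\<forall>z\<in>\<D>. cmod (\<phi> z - g z) < \<epsilon>))}"

definition disk_norm :: "(complex \<Rightarrow> complex) \<Rightarrow> real" where
  "disk_norm \<phi> = (SUP z\<in>\<D>. cmod (\<phi> z))"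

definition hilbert_module ::
    "((complex \<Rightarrow> complex) \<Rightarrow> 'a \<Rightarrow> 'a::{complex_hilbert_space, second_countable_topology}) \<Rightarrow> bool" where
  "hilbert_module act \<longleftrightarrow>
     (\<forall>\<phi>\<in>disk_algebra. clinear (act \<phi>)) \<and>
     (\<forall>\<phi>\<in>disk_algebra. \<forall>\<psi>\<in>disk_algebra. \<forall>f. act (\<lambda>z. \<phi> z + \<psi> z) f = act \<phi> f + act \<psi> f) \<and>
     (\<forall>c. \<forall>\<phi>\<in>disk_algebra. \<forall>f. act (\<lambda>z. c * \<phi> z) f = c *\<^sub>C act \<phi> f) \<and>
     (\<forall>\<phi>\<in>disk_algebra. \<forall>\<psi>\<in>disk_algebra. \<forall>f. act (\<lambda>z. \<phi> z * \<psi> z) f = act \<phi> (act \<psi> f)) \<and>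
     (\<forall>f. act (\<lambda>z. if z \<in> \<D> then 1 else 0) f = f) \<and>
     (\<forall>\<phi>\<in>disk_algebra. \<forall>f. norm (act \<phi> f) \<le> disk_norm \<phi> * norm f)"

definition essentially_reductive ::
    "((complex \<Rightarrow> complex) \<Rightarrow> 'a \<Rightarrow> 'a::{complex_hilbert_space, second_countable_topology}) \<Rightarrow> bool" where
  "essentially_reductive act \<longleftrightarrow>
     (\<forall>\<phi>\<in>disk_algebra.
        compact_operator (\<lambda>f. cadjoint (act \<phi>) (act \<phi> f) - act \<phi> (cadjoint (act \<phi>) f)))"

definition module_map ::
    "((complex \<Rightarrow> complex) \<Rightarrow> 'a \<Rightarrow> 'a::complex_hilbert_space) \<Rightarrow>
     ((complex \<Rightarrow> complex) \<Rightarrow> 'b \<Rightarrow> 'b::complex_hilbert_space) \<Rightarrow> ('a \<Rightarrow> 'b) \<Rightarrow> bool" where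
  "module_map act act' T \<longleftrightarrow>
     clinear T \<and> bounded_linear T \<and> (\<forall>\<phi>\<in>disk_algebra. \<forall>f. T (act \<phi> f) = act' \<phi> (T f))"

text \<open>
  The algebraic tensor product of the disk algebra with the space \<open>'e\<close>, where an element
  \<open>\<Sum>\<theta>\<^sub>i \<otimes> x\<^sub>i\<close> is identified with the function \<open>z \<mapsto> \<Sum>\<theta>\<^sub>i(z) x\<^sub>i\<close>. This identification is injective,
  and evaluation at \<open>z\<close> becomes evaluation of functions.
\<close>

definition disk_tensor :: "(complex \<Rightarrow> 'e::complex_hilbert_space) set" where
  "disk_tensor = {F. \<exists>(n::nat) \<theta> x. (\<forall>i<n. \<theta> i \<in> disk_algebra) \<and> F = (\<lambda>z. \<Sum>i<n. \<theta> i z *\<^sub>C x i)}"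

text \<open>
  The Hilbert space \<open>'a\<close> with module action \<open>act\<close> is quasi-free over the disk algebra, with
  coefficient space \<open>'e\<close> in the role of the Hilbert space of dimension \<open>m\<close>; the rank is the
  dimension of \<open>'e\<close>. The map \<open>J\<close> is the embedding of the algebraic tensor product into its
  completion \<open>'a\<close>, so \<open>cinner (J F) (J G)\<close> is the given inner product on the tensor product.
\<close>

definition quasi_free_module ::
    "((complex \<Rightarrow> complex) \<Rightarrow> 'a \<Rightarrow> 'a::{complex_hilbert_space, second_countable_topology}) \<Rightarrow>
     ((complex \<Rightarrow> 'e::{complex_hilbert_space, second_countable_topology}) \<Rightarrow> 'a) \<Rightarrow> bool" where
  "quasi_free_module act J \<longleftrightarrow>
     hilbert_module act \<and>
     (\<exists>x::'e. x \<noteq> 0) \<and>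
     (\<forall>F\<in>disk_tensor. \<forall>G\<in>disk_tensor. J (\<lambda>z. F z + G z) = J F + J G) \<and>
     (\<forall>c. \<forall>F\<in>disk_tensor. J (\<lambda>z. c *\<^sub>C F z) = c *\<^sub>C J F) \<and>
     inj_on J disk_tensor \<and>
     closure (J ` disk_tensor) = UNIV \<and>
     (\<forall>\<phi>\<in>disk_algebra. \<forall>F\<in>disk_tensor. act \<phi> (J F) = J (\<lambda>z. \<phi> z *\<^sub>C F z)) \<and>
     (\<forall>z\<in>\<D>. \<exists>C. \<forall>F\<in>disk_tensor. norm (F z) \<le> C * norm (J F)) \<and>
     (\<forall>z\<in>\<D>. \<exists>r>0. \<exists>C. \<forall>w\<in>ball z r \<inter> \<D>. \<forall>F\<in>disk_tensor. norm (F w) \<le> C * norm (J F)) \<and>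
     (\<forall>\<phi>\<in>disk_algebra. \<forall>F\<in>disk_tensor.
        norm (J (\<lambda>z. \<phi> z *\<^sub>C F z)) \<le> disk_norm \<phi> * norm (J F)) \<and>
     (\<forall>F :: nat \<Rightarrow> complex \<Rightarrow> 'e. (\<forall>i. F i \<in> disk_tensor) \<and> Cauchy (\<lambda>i. J (F i)) \<longrightarrow>
        ((\<forall>z\<in>\<D>. (\<lambda>i. F i z) \<longlonglongrightarrow> 0) \<longleftrightarrow> (\<lambda>i. norm (J (F i))) \<longlonglongrightarrow> 0))"

text \<open>
  The Hardy space of functions with values in a closed subspace \<open>F\<close>, described by power series
  with square-summable coefficients in \<open>F\<close>. Functions again vanish off the disk.
\<close>

definition hardy_series :: "(nat \<Rightarrow> 'f::complex_hilbert_space) \<Rightarrow> (complex \<Rightarrow> 'f) \<Rightarrow> bool" where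
  "hardy_series a f \<longleftrightarrow>
     summable (\<lambda>n. (norm (a n))\<^sup>2) \<and>
     (\<forall>z\<in>\<D>. (\<lambda>n. z ^ n *\<^sub>C a n) sums f z) \<and> (\<forall>z. z \<notin> \<D> \<longrightarrow> f z = 0)"

definition hardy_space :: "'f::complex_hilbert_space set \<Rightarrow> (complex \<Rightarrow> 'f) set" where
  "hardy_space F = {f. \<exists>a. range a \<subseteq> F \<and> hardy_series a f}"

definition hardy_coeffs :: "(complex \<Rightarrow> 'f::complex_hilbert_space) \<Rightarrow> nat \<Rightarrow> 'f" where
  "hardy_coeffs f = (THE a. hardy_series a f)"

definition hardy_inner :: "(complex \<Rightarrow> 'f::complex_hilbert_space) \<Rightarrow> (complex \<Rightarrow> 'f) \<Rightarrow> complex" where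
  "hardy_inner f g = (\<Sum>n. cinner (hardy_coeffs f n) (hardy_coeffs g n))"

lemma powser_zero_imp_coeff_zero:
  fixes c :: "nat \<Rightarrow> complex"
  assumes "\<And>z. z \<in> \<D> \<Longrightarrow> (\<lambda>n. c n * z ^ n) sums 0"
  shows "c n = 0"
proof (induction n rule: less_induct)
  case (less n)
  have sums: "(\<lambda>k. c (k + n) * z ^ k) sums 0" if "norm z < 1" "z \<noteq> 0" for z
  proof -
    have "(\<lambda>k. c (k + n) * z ^ (k + n)) sums (0 - (\<Sum>i<n. c i * z ^ i))"
      using sums_split_initial_segment[OF assms, of z n] that by simp
    moreover have "(\<Sum>i<n. c i * z ^ i) = 0" using less by simp
    ultimately have "(\<lambda>k. c (k + n) * z ^ (k + n) / z ^ n) sums (0 / z ^ n)"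
      by (intro sums_divide) simp
    then show ?thesis using that by (simp add: power_add)
  qed
  have "((\<lambda>z::complex. 0) \<longlongrightarrow> c (0 + n)) (at 0)"
    by (rule powser_limit_0_strong[of 1 "\<lambda>k. c (k + n)"]) (use sums in auto)
  then show ?case using LIM_unique[OF tendsto_const[of "0::complex" "at (0::complex)"]] by simp
qed

lemma hardy_series_unique:
  assumes "hardy_series a f" "hardy_series b f"
  shows "a = b"
proof
  fix n
  have "cinner (a n - b n) v = 0" for v :: 'a
  proof (rule powser_zero_imp_coeff_zero[of "\<lambda>n. cinner (a n - b n) v"])
    fix z :: complex assume "z \<in> \<D>"
    then have "(\<lambda>n. z ^ n *\<^sub>C a n - z ^ n *\<^sub>C b n) sums (f z - f z)"
      using assms unfolding hardy_series_def by (intro sums_diff) auto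
    then have "(\<lambda>n. cinner (z ^ n *\<^sub>C (a n - b n)) v) sums cinner 0 v"
      by (intro bounded_linear.sums[OF bounded_linear_cinner_left])
        (simp add: complex_vector.scale_right_diff_distrib)
    moreover have "cinner 0 v = 0"
      by (rule linear_simps(3)[OF bounded_linear_cinner_left])
    ultimately show "(\<lambda>n. cinner (a n - b n) v * z ^ n) sums 0"
      by (simp add: cinner_scaleC_left mult.commute)
  qed
  then have "cinner (a n - b n) (a n - b n) = 0" .
  then have "inner (a n - b n) (a n - b n) = 0"
    by (simp add: inner_Re_cinner)
  then show "a n = b n" by simp
qed

lemma hardy_coeffs_eq: "hardy_series a f \<Longrightarrow> hardy_coeffs f = a"
  unfolding hardy_coeffs_def using hardy_series_unique by blast

definition unitarily_equivalent_hardy ::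
    "((complex \<Rightarrow> complex) \<Rightarrow> 'a \<Rightarrow> 'a::complex_hilbert_space) \<Rightarrow>
     'f::complex_hilbert_space set \<Rightarrow> bool" where
  "unitarily_equivalent_hardy act F \<longleftrightarrow>
     (\<exists>W :: 'a \<Rightarrow> complex \<Rightarrow> 'f.
        (\<forall>f g. W (f + g) = (\<lambda>z. W f z + W g z)) \<and>
        (\<forall>c f. W (c *\<^sub>C f) = (\<lambda>z. c *\<^sub>C W f z)) \<and>
        range W = hardy_space F \<and>
        (\<forall>f g. hardy_inner (W f) (W g) = cinner f g) \<and>
        (\<forall>\<phi>\<in>disk_algebra. \<forall>f. W (act \<phi> f) = (\<lambda>z. \<phi> z *\<^sub>C W f z)))"

end

theory Submission
  imports Defs "HOL-Complex_Analysis.Complex_Analysis"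
begin

text \<open>
  Let \<open>T\<close> be multiplication by the coordinate function. Since \<open>U\<^sup>n f\<close> tends weakly to \<open>0\<close>, compact
  operators vanish along it, and essential normality gives
  \<open>\<langle>(T\<^sup>*T)\<^sup>j U\<^sup>n f, U\<^sup>n f\<rangle> \<rightarrow> \<parallel>T\<^sup>j f\<parallel>\<^sup>2\<close>. As \<open>0 \<le> T\<^sup>*T \<le> 1\<close>, the sequence \<open>\<parallel>T\<^sup>j f\<parallel>\<^sup>2\<close> is a Hausdorff moment
  sequence, of a measure \<open>\<mu>\<^sub>f\<close> on \<open>[0,1]\<close> with \<open>\<mu>\<^sub>U\<^sub>f = \<mu>\<^sub>f\<close>. For \<open>s < 1\<close> the seminorm
  \<open>q(f) = \<mu>\<^sub>f([0,s])\<^sup>1\<^sup>/\<^sup>2\<close> satisfies \<open>q(T\<^sup>n f) \<le> s\<^sup>n\<^sup>/\<^sup>2 \<parallel>f\<parallel>\<close>, so that it is controlled by the Taylor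
  coefficients \<open>f\<^sub>n\<close> of \<open>f\<close>: \<open>q(f) \<le> C \<Sum>\<^sub>n s\<^sup>n\<^sup>/\<^sup>2 |f\<^sub>n|\<close>. These are bounded functionals growing
  subexponentially in \<open>n\<close>, because evaluations are locally bounded; hence
  \<open>q(f) = q(U\<^sup>k f) \<rightarrow> 0\<close>. So \<open>\<mu>\<^sub>f\<close> is concentrated at \<open>1\<close>, which means that \<open>T\<close> is an isometry.
  Quasi-freeness makes \<open>T\<close> pure with \<open>dim ker T\<^sup>*\<close> equal to the rank, and the Wold decomposition of
  \<open>T\<close> identifies the module with the Hardy space over \<open>ker T\<^sup>*\<close>. To avoid measures, \<open>\<mu>\<^sub>f([0,s])\<close> is
  replaced by its Bernstein approximations.
\<close>

section \<open>Complex inner products and adjoints\<close>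

lemma cinner_scaleC_right: "cinner x (c *\<^sub>C y) = cnj c * cinner x y"
  for x :: "'a::complex_hilbert_space"
  by (subst (1 2) cinner_commute) (simp add: cinner_scaleC_left)

lemma bounded_linear_cinner_right:
  "bounded_linear (cinner x)" for x :: "'a::complex_hilbert_space"
proof -
  have "(\<lambda>y. cnj (cinner y x)) = cinner x"
    by (rule ext) (rule cinner_commute[symmetric])
  then show ?thesis
    using bounded_linear_compose[OF bounded_linear_cnj bounded_linear_cinner_left[of x]] by simp
qed

lemmas cinner_zero_left [simp] = linear_simps(3)[OF bounded_linear_cinner_left]
  and cinner_zero_right [simp] = linear_simps(3)[OF bounded_linear_cinner_right]
  and cinner_minus_left = linear_simps(4)[OF bounded_linear_cinner_left]
  and cinner_diff_left = linear_simps(2)[OF bounded_linear_cinner_left]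
  and cinner_diff_right = linear_simps(2)[OF bounded_linear_cinner_right]
  and cinner_sum_left = linear_sum[OF bounded_linear.linear[OF bounded_linear_cinner_left]]
  and tendsto_cinner_left = bounded_linear.tendsto[OF bounded_linear_cinner_left]
  and tendsto_cinner_right = bounded_linear.tendsto[OF bounded_linear_cinner_right]

lemma cinner_self: "cinner x x = of_real ((norm x)\<^sup>2)" for x :: "'a::complex_hilbert_space"
proof (rule complex_eqI)
  show "Re (cinner x x) = Re (of_real ((norm x)\<^sup>2))"
    by (simp add: inner_Re_cinner[symmetric] power2_norm_eq_inner)
  have "Im (cinner x x) = - Im (cinner x x)"
    by (subst cinner_commute) simp
  then show "Im (cinner x x) = Im (of_real ((norm x)\<^sup>2))" by simp
qed

lemma norm_scaleC [simp]: "norm (c *\<^sub>C x) = cmod c * norm x" for x :: "'a::complex_hilbert_space"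
proof -
  have "complex_of_real ((norm (c *\<^sub>C x))\<^sup>2) = of_real ((cmod c * norm x)\<^sup>2)"
    by (simp only: cinner_self[symmetric] cinner_scaleC_left cinner_scaleC_right)
       (simp add: cinner_self power_mult_distrib complex_norm_square[unfolded of_real_power] mult_ac)
  then show ?thesis
    by (simp only: of_real_eq_iff power2_eq_iff_nonneg norm_ge_zero mult_nonneg_nonneg)
qed

lemma norm_cinner_le: "cmod (cinner x y) \<le> norm x * norm y" for x :: "'a::complex_hilbert_space"
proof (cases "cinner x y = 0")
  case False
  \<comment> \<open>\<open>c\<close> has modulus 1 and rotates \<open>cinner x y\<close> onto the
    positive real axis, so the real Cauchy-Schwarz inequality for \<open>c *\<^sub>C x\<close>
    suffices.\<close>
  define c where "c = cnj (sgn (cinner x y))"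
  have c: "cmod c = 1" using False by (simp add: c_def norm_sgn)
  have "c * cinner x y = of_real (cmod (cinner x y))"
    using False unfolding c_def
    by (simp add: sgn_div_norm scaleR_conv_of_real complex_norm_square[symmetric]
        power2_eq_square field_simps)
  then have "cmod (cinner x y) = inner (c *\<^sub>C x) y"
    by (simp add: inner_Re_cinner cinner_scaleC_left)
  also have "\<dots> \<le> norm (c *\<^sub>C x) * norm y" by (rule norm_cauchy_schwarz)
  finally show ?thesis using c by simp
qed simp

lemma cinner_eqI: "(\<And>z. cinner x z = cinner y z) \<Longrightarrow> x = y" for x :: "'a::complex_hilbert_space"
  using cinner_self[of "x - y"] by (simp add: cinner_diff_left)

lemma bounded_linear_scaleC_right: "bounded_linear (\<lambda>x. c *\<^sub>C x)"
  for c :: complex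
  by (rule bounded_linear_intro[where K="cmod c"])
     (auto simp: scaleC_add_right scaleR_scaleC scaleC_scaleC mult.commute)

lemma bounded_linear_scaleC_left: "bounded_linear (\<lambda>c. c *\<^sub>C x)"
  for x :: "'a::complex_hilbert_space"
  by (rule bounded_linear_intro[where K="norm x"])
     (auto simp: scaleC_add_left scaleR_scaleC[of _ "c *\<^sub>C x" for c] scaleC_scaleC scaleR_conv_of_real)

lemma clinear_iff:
  "clinear T \<longleftrightarrow> (\<forall>x y. T (x + y) = T x + T y) \<and> (\<forall>c x. T (c *\<^sub>C x) = c *\<^sub>C T x)"
  unfolding Vector_Spaces.linear_def module_hom_def module_hom_axioms_def
  by (auto intro: complex_vector.vector_space_axioms complex_vector.module_axioms)

lemma clinear_bounded_linear:
  assumes "clinear T" "\<And>x. norm (T x) \<le> norm x * K"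
  shows "bounded_linear T"
  using assms by (intro bounded_linear_intro[where K=K]) (auto simp: clinear_iff scaleR_scaleC)

lemma csubspace_iff:
  "csubspace S \<longleftrightarrow> 0 \<in> S \<and> (\<forall>x\<in>S. \<forall>y\<in>S. x + y \<in> S) \<and> (\<forall>c. \<forall>x\<in>S. c *\<^sub>C x \<in> S)"
  by (rule complex_vector.subspace_def)

text \<open>The functional is given as a linear relation, so that it need not be shown beforehand
  to be well defined on its domain. The vector arises by minimizing \<open>\<parallel>v\<parallel>\<^sup>2 - 2 Re c\<close>.\<close>

lemma riesz_representation:
  fixes R :: "'a::complex_hilbert_space \<Rightarrow> complex \<Rightarrow> bool"
  assumes zero: "R 0 0"
    and add: "\<And>v w c d. R v c \<Longrightarrow> R w d \<Longrightarrow> R (v + w) (c + d)"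
    and scale: "\<And>a v c. R v c \<Longrightarrow> R (a *\<^sub>C v) (a * c)"
    and bound: "\<And>v c. R v c \<Longrightarrow> cmod c \<le> K * norm v"
    and K: "K \<ge> 0"
  obtains y where "norm y \<le> K" "\<And>v c. R v c \<Longrightarrow> c = cinner v y"
proof -
  define G where "G = {(norm v)\<^sup>2 - 2 * Re c | v c. R v c}"
  define I where "I = Inf G"
  have ne: "G \<noteq> {}" using zero unfolding G_def by blast
  have lower: "- K\<^sup>2 \<le> g" if "g \<in> G" for g
  proof -
    from that obtain v c where g: "g = (norm v)\<^sup>2 - 2 * Re c" and R: "R v c"
      unfolding G_def by blast
    have "Re c \<le> K * norm v" using bound[OF R] complex_Re_le_cmod[of c] by linarith
    moreover have "0 \<le> (norm v - K)\<^sup>2" by simp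
    ultimately show ?thesis unfolding g power2_diff by (simp add: mult.commute)
  qed
  have bdd: "bdd_below G" using lower by (rule bdd_belowI)
  have I_le: "I \<le> (norm v)\<^sup>2 - 2 * Re c" if "R v c" for v c
    unfolding I_def by (rule cInf_lower[OF _ bdd]) (use that G_def in blast)
  have "\<exists>v c. R v c \<and> (norm v)\<^sup>2 - 2 * Re c < I + 1 / real (Suc n)" for n
  proof -
    have "\<exists>g\<in>G. g < I + 1 / real (Suc n)"
      unfolding I_def by (rule cInf_lessD[OF ne, of "Inf G + 1 / real (Suc n)"]) simp
    then show ?thesis unfolding G_def by blast
  qed
  then obtain v c where R: "\<And>n. R (v n) (c n)"
    and less: "\<And>n. (norm (v n))\<^sup>2 - 2 * Re (c n) < I + 1 / real (Suc n)"
    by metis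
  \<comment> \<open>Parallelogram law: the midpoint of two almost minimizing pairs again satisfies
    \<open>R\<close>, so its value is at least \<open>I\<close>, which forces \<open>v m\<close> and
    \<open>v n\<close> together.\<close>
  have dist: "(norm (v m - v n))\<^sup>2 \<le> 2 / real (Suc m) + 2 / real (Suc n)" for m n
  proof -
    have "R ((1/2) *\<^sub>C (v m + v n)) ((1/2) * (c m + c n))" by (intro scale add R)
    moreover have "(norm ((1/2) *\<^sub>C (v m + v n)))\<^sup>2 = (norm (v m + v n))\<^sup>2 / 4"
      by (simp add: norm_divide power_divide)
    ultimately have "4 * I \<le> (norm (v m + v n))\<^sup>2 - 4 * Re (c m) - 4 * Re (c n)"
      using I_le[of "(1/2) *\<^sub>C (v m + v n)" "(1/2) * (c m + c n)"]
      by (simp add: power_divide) argo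
    moreover have "(norm (v m - v n))\<^sup>2 + (norm (v m + v n))\<^sup>2 = 2 * (norm (v m))\<^sup>2 + 2 * (norm (v n))\<^sup>2"
      by (simp add: power2_norm_eq_inner inner_add_left inner_add_right inner_diff_left
          inner_diff_right inner_commute)
    ultimately show ?thesis using less[of m] less[of n] by simp
  qed
  have "Cauchy v"
  proof (rule metric_CauchyI)
    fix e :: real assume e: "e > 0"
    obtain N where N: "4 / real (Suc N) < e\<^sup>2"
    proof -
      obtain N where "4 / e\<^sup>2 < real N" using reals_Archimedean2 by blast
      then have "4 / real (Suc N) < e\<^sup>2" using e
        by (simp add: divide_less_eq less_divide_eq field_simps)
           (smt (verit) zero_less_power)
      then show ?thesis using that by blast
    qed
    show "\<exists>M. \<forall>m\<ge>M. \<forall>n\<ge>M. dist (v m) (v n) < e"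
    proof (intro exI[of _ N] allI impI)
      fix m n assume "m \<ge> N" "n \<ge> N"
      then have "2 / real (Suc m) \<le> 2 / real (Suc N)" "2 / real (Suc n) \<le> 2 / real (Suc N)"
        by (auto intro!: divide_left_mono)
      then have "(norm (v m - v n))\<^sup>2 < e\<^sup>2" using dist[of m n] N by simp
      then show "dist (v m) (v n) < e"
        unfolding dist_norm using e by (simp add: power2_less_imp_less)
    qed
  qed
  then obtain y where y: "v \<longlonglongrightarrow> y" using Cauchy_convergent convergent_def by blast
  have Re: "Re d = inner w y" if Rw: "R w d" for w d
  proof -
    \<comment> \<open>The \<open>v n\<close> are almost minimal, so moving them by \<open>t\<close>
      times \<open>w\<close> cannot lower the value in the limit. A quadratic in \<open>t\<close>
      that is nonnegative for all real \<open>t\<close> and vanishes at 0 has no linear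
      term.\<close>
    have lim: "0 \<le> 2 * t * (inner y w - Re d) + t\<^sup>2 * (norm w)\<^sup>2" for t
    proof -
      have "0 \<le> 1 / real (Suc n) + (2 * t * (inner (v n) w - Re d) + t\<^sup>2 * (norm w)\<^sup>2)" for n
      proof -
        have "R (v n + of_real t *\<^sub>C w) (c n + of_real t * d)" by (intro scale add R Rw)
        moreover have "(norm (v n + of_real t *\<^sub>C w))\<^sup>2
            = (norm (v n))\<^sup>2 + 2 * t * inner (v n) w + t\<^sup>2 * (norm w)\<^sup>2"
          unfolding scaleR_scaleC[symmetric] power2_norm_eq_inner
          by (simp add: inner_add_left inner_add_right inner_commute power2_eq_square)
        ultimately show ?thesis
          using I_le[of "v n + of_real t *\<^sub>C w" "c n + of_real t * d"] less[of n]
          by (simp add: algebra_simps)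
      qed
      moreover have "(\<lambda>n. 1 / real (Suc n) + (2 * t * (inner (v n) w - Re d) + t\<^sup>2 * (norm w)\<^sup>2))
          \<longlonglongrightarrow> 0 + (2 * t * (inner y w - Re d) + t\<^sup>2 * (norm w)\<^sup>2)"
        by (intro tendsto_intros y LIMSEQ_Suc[OF lim_1_over_n])
      ultimately show ?thesis by (intro LIMSEQ_le_const) auto
    qed
    define p where "p = inner y w - Re d"
    have "p = 0"
    proof (rule ccontr)
      assume p: "p \<noteq> 0"
      define q where "q = (norm w)\<^sup>2 + 1"
      have q: "q > 0" unfolding q_def by (simp add: add_nonneg_pos)
      have "0 \<le> 2 * (- p / q) * p + (- p / q)\<^sup>2 * (norm w)\<^sup>2"
        using lim[of "- p / q"] unfolding p_def by simp
      also have "\<dots> \<le> 2 * (- p / q) * p + (- p / q)\<^sup>2 * q"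
        unfolding q_def by (intro add_left_mono mult_left_mono) auto
      also have "\<dots> = - (p\<^sup>2 / q)" using q by (simp add: power2_eq_square field_simps)
      also have "\<dots> < 0" using p q by simp
      finally show False by simp
    qed
    then show ?thesis unfolding p_def by (simp add: inner_commute)
  qed
  have rep: "d = cinner w y" if Rw: "R w d" for w d
  proof (rule complex_eqI)
    show "Re d = Re (cinner w y)" using Re[OF Rw] by (simp add: inner_Re_cinner)
    \<comment> \<open>The imaginary part of \<open>d\<close> is the real part of the value at
      \<open>- \<i> *\<^sub>C w\<close>.\<close>
    show "Im d = Im (cinner w y)"
      using Re[OF scale[OF Rw, of "- \<i>"]] by (simp add: inner_Re_cinner cinner_scaleC_left
          cinner_minus_left)
  qed
  have "norm y \<le> K"
  proof -
    have "cmod (cinner (v n) y) \<le> K * norm (v n)" for n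
      using bound[OF R[of n]] rep[OF R[of n]] by simp
    then have "cmod (cinner y y) \<le> K * norm y"
      by (intro tendsto_le[OF _ tendsto_mult[OF tendsto_const tendsto_norm[OF y]]
            tendsto_norm[OF tendsto_cinner_left[OF y]]]) auto
    then have "norm y * norm y \<le> K * norm y"
      by (simp add: cinner_self power2_eq_square norm_mult)
    then show ?thesis using K by (cases "y = 0") auto
  qed
  with rep show ?thesis using that by blast
qed

lemma adjoint_exists:
  fixes T :: "'a::complex_hilbert_space \<Rightarrow> 'b::complex_hilbert_space"
  assumes T: "clinear T" and K: "\<And>x. norm (T x) \<le> norm x * K"
  obtains S where "\<And>x y. cinner (T x) y = cinner x (S y)"
proof -
  have lin: "T (x + y) = T x + T y" "T (c *\<^sub>C x) = c *\<^sub>C T x" for x y c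
    using T by (auto simp: clinear_iff)
  have "\<exists>w. \<forall>x. cinner (T x) y = cinner x w" for y
  proof -
    have T0: "T 0 = 0" using lin(2)[of 0 0] by simp
    have "\<exists>w. norm w \<le> \<bar>K\<bar> * norm y \<and> (\<forall>v c. c = cinner (T v) y \<longrightarrow> c = cinner v w)"
    proof (rule riesz_representation[of "\<lambda>v c. c = cinner (T v) y" "\<bar>K\<bar> * norm y"])
      show "cmod c \<le> \<bar>K\<bar> * norm y * norm v" if "c = cinner (T v) y" for v c
      proof -
        have "cmod c \<le> norm (T v) * norm y" using that by (simp add: norm_cinner_le)
        also have "\<dots> \<le> (norm v * \<bar>K\<bar>) * norm y"
          by (intro mult_right_mono order_trans[OF K mult_left_mono]) auto
        finally show ?thesis by (simp add: mult_ac)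
      qed
    qed (auto simp: lin cinner_add_left cinner_scaleC_left T0)
    then show ?thesis by auto
  qed
  then obtain S where "\<And>y x. cinner (T x) y = cinner x (S y)" by metis
  then show ?thesis using that by blast
qed

section \<open>Contractions and pure isometries\<close>

text \<open>The adjoint is a parameter characterized by its inner products. The hypotheses are then
  inherited by the reversed pair and by powers, so facts about one transfer to the others.\<close>

locale contraction_pair =
  fixes T S :: "'a::complex_hilbert_space \<Rightarrow> 'a"
  assumes clinear: "clinear T"
    and norm_le: "norm (T x) \<le> norm x"
    and adj: "cinner (T x) y = cinner x (S y)"
begin

lemma adj': "cinner (S x) y = cinner x (T y)"
  using adj[of y x] by (metis cinner_commute)

lemma adj_clinear: "clinear S"
  unfolding clinear_iff
proof (intro conjI allI)
  show "S (x + y) = S x + S y" for x y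
    by (rule cinner_eqI) (simp add: adj' cinner_add_left)
  show "S (c *\<^sub>C x) = c *\<^sub>C S x" for c x
    by (rule cinner_eqI) (simp add: adj' cinner_scaleC_left)
qed

lemma adj_norm_le: "norm (S x) \<le> norm x"
proof -
  have "(norm (S x))\<^sup>2 = cmod (cinner (T (S x)) x)"
    by (simp add: adj cinner_self norm_power)
  also have "\<dots> \<le> norm (S x) * norm x"
    by (rule order_trans[OF norm_cinner_le]) (intro mult_right_mono norm_le norm_ge_zero)
  finally show ?thesis by (cases "S x = 0") (simp_all add: power2_eq_square)
qed

sublocale adjoint: contraction_pair S T
  by (intro contraction_pair.intro adj_clinear adj_norm_le adj')

lemma add [simp]: "T (x + y) = T x + T y" and scaleC [simp]: "T (c *\<^sub>C x) = c *\<^sub>C T x"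
  using clinear by (auto simp: clinear_iff)

lemma bounded_linear: "bounded_linear T"
  using clinear norm_le by (intro clinear_bounded_linear[where K=1]) auto

lemmas zero [simp] = linear_simps(3)[OF bounded_linear]
  and diff = linear_simps(2)[OF bounded_linear]
  and sum = linear_sum[OF bounded_linear.linear[OF bounded_linear]]
  and tendsto = bounded_linear.tendsto[OF bounded_linear]

lemma funpow_contraction_pair: "contraction_pair (T ^^ n) (S ^^ n)"
proof (induction n)
  case 0
  show ?case by (rule contraction_pair.intro) (auto simp: clinear_iff)
next
  case (Suc n)
  interpret n: contraction_pair "T ^^ n" "S ^^ n" by fact
  show ?case
  proof (rule contraction_pair.intro)
    show "clinear (T ^^ Suc n)" by (simp add: clinear_iff)
    show "norm ((T ^^ Suc n) x) \<le> norm x" for x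
      using order_trans[OF norm_le n.norm_le] by simp
    show "cinner ((T ^^ Suc n) x) y = cinner x ((S ^^ Suc n) y)" for x y
      by (simp add: adj n.adj funpow_swap1)
  qed
qed

end

definition weakly_null :: "(nat \<Rightarrow> 'a::complex_hilbert_space) \<Rightarrow> bool" where
  "weakly_null x \<longleftrightarrow> (\<exists>K. \<forall>n. norm (x n) \<le> K) \<and> (\<forall>y. (\<lambda>n. cinner (x n) y) \<longlonglongrightarrow> 0)"

lemma (in contraction_pair) weakly_null_image:
  assumes "weakly_null x"
  shows "weakly_null (\<lambda>n. T (x n))"
proof -
  obtain K where "\<And>n. norm (x n) \<le> K" using assms unfolding weakly_null_def by blast
  then have "norm (T (x n)) \<le> K" for n using norm_le order_trans by blast
  then show ?thesis using assms unfolding weakly_null_def adj by blast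
qed

text \<open>If the images stayed away from 0 along a subsequence, compactness would give a norm
  limit \<open>l\<close> of a further subsequence. Moving \<open>C\<close> to its adjoint
  \<open>D\<close> turns weak convergence into \<open>cinner l l = 0\<close>, contradicting the
  lower bound on \<open>norm l\<close>.\<close>

lemma compact_operator_weakly_null:
  fixes C :: "'a::complex_hilbert_space \<Rightarrow> 'a"
  assumes C: "compact_operator C" and adj: "\<And>x y. cinner (C x) y = cinner x (D y)"
    and x: "weakly_null x"
  shows "(\<lambda>n. C (x n)) \<longlonglongrightarrow> 0"
proof -
  obtain K where K: "\<And>n. norm (x n) \<le> K" using x unfolding weakly_null_def by blast
  define b where "b = \<bar>K\<bar> + 1"
  have b: "b > 0" "\<And>n. norm (x n) \<le> b" using K unfolding b_def
    by (auto intro: order_trans[OF _ order_trans[OF abs_ge_self[of K]]])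
  define u where "u n = of_real (1 / b) *\<^sub>C x n" for n
  have scale: "C (c *\<^sub>C v) = c *\<^sub>C C v" for c v
    using C unfolding compact_operator_def clinear_iff by blast
  have u: "u n \<in> cball 0 1" for n using b by (simp add: u_def norm_divide)
  have "(\<lambda>n. C (u n)) \<longlonglongrightarrow> 0"
  proof (rule ccontr)
    assume "\<not> ?thesis"
    then obtain e where e: "e > 0" and "\<exists>\<^sub>F n in sequentially. norm (C (u n)) \<ge> e"
      by (auto simp: tendsto_iff frequently_def not_le)
    then have "infinite {n. norm (C (u n)) \<ge> e}"
      by (simp add: frequently_cofinite[symmetric] cofinite_eq_sequentially)
    then obtain r :: "nat \<Rightarrow> nat" where r: "strict_mono r" "\<And>n. norm (C (u (r n))) \<ge> e"
      using infinite_enumerate by blast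
    have "compact (closure (C ` cball 0 1))" using C unfolding compact_operator_def by blast
    moreover have "\<forall>n. C (u (r n)) \<in> closure (C ` cball 0 1)"
      using u closure_subset by blast
    ultimately obtain l s where s: "strict_mono s" and l: "((\<lambda>n. C (u (r n))) \<circ> s) \<longlonglongrightarrow> l"
      unfolding compact_def by meson
    have "(\<lambda>n. cinner (x n) (D l)) \<longlonglongrightarrow> 0" using x unfolding weakly_null_def by blast
    then have "(\<lambda>n. of_real (1 / b) * cinner (x n) (D l)) \<longlonglongrightarrow> of_real (1 / b) * 0"
      by (intro tendsto_intros)
    then have "(\<lambda>n. cinner (C (u n)) l) \<longlonglongrightarrow> 0"
      by (simp add: adj u_def cinner_scaleC_left)
    then have "(\<lambda>n. cinner (C (u ((r \<circ> s) n))) l) \<longlonglongrightarrow> 0"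
      using LIMSEQ_subseq_LIMSEQ[OF _ strict_mono_o[OF r(1) s]] by (simp add: o_def)
    moreover have "(\<lambda>n. cinner (C (u ((r \<circ> s) n))) l) \<longlonglongrightarrow> cinner l l"
      using tendsto_cinner_left[OF l] by (simp add: o_def)
    ultimately have "cinner l l = 0" using LIMSEQ_unique by blast
    then have "l = 0" by (simp add: cinner_self)
    moreover have "norm l \<ge> e"
      by (rule LIMSEQ_le_const[OF tendsto_norm[OF l]]) (use r(2) in auto)
    ultimately show False using e by simp
  qed
  then have "(\<lambda>n. of_real b *\<^sub>C C (u n)) \<longlonglongrightarrow> of_real b *\<^sub>C 0"
    by (rule bounded_linear.tendsto[OF bounded_linear_scaleC_right])
  then show ?thesis using b by (simp add: u_def scale scaleC_scaleC)
qed

section \<open>Pure isometries and the decay of their adjoint powers\<close>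

locale pure_isometry = contraction_pair T S for T S :: "'a::complex_hilbert_space \<Rightarrow> 'a" +
  assumes isometry: "norm (T x) = norm x"
    and pure: "(\<Inter>k::nat. range (T ^^ k)) = {0}"
begin

text \<open>Expanding the square of \<open>norm (S (T x) - x)\<close> gives
  \<open>norm (S (T x))\<close> squared minus \<open>norm x\<close> squared, which is at most 0
  since \<open>S\<close> is a contraction and \<open>T\<close> an isometry.\<close>

lemma adj_left_inverse [simp]: "S (T x) = x"
proof -
  have "(norm (S (T x) - x))\<^sup>2 \<le> 0"
  proof -
    have "inner (S (T x)) x = (norm x)\<^sup>2"
      by (simp add: inner_Re_cinner adj' cinner_self isometry)
    moreover have "(norm (S (T x)))\<^sup>2 \<le> (norm x)\<^sup>2"
      using adj_norm_le[of "T x"] isometry by (simp add: power_mono)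
    ultimately show ?thesis
      by (simp add: power2_norm_eq_inner inner_diff_left inner_diff_right inner_commute)
  qed
  then show ?thesis by simp
qed

lemma adj_funpow_left_inverse [simp]: "(S ^^ n) ((T ^^ n) x) = x"
proof (induction n arbitrary: x)
  case (Suc n)
  have "(S ^^ Suc n) ((T ^^ Suc n) x) = (S ^^ n) (S (T ((T ^^ n) x)))"
    by (simp add: funpow_swap1)
  then show ?case using Suc by simp
qed simp

lemma funpow_isometry: "norm ((T ^^ n) x) = norm x"
  by (induction n) (simp_all add: isometry)

lemma cinner_funpow: "cinner ((T ^^ n) x) ((T ^^ n) y) = cinner x y"
  using contraction_pair.adj[OF funpow_contraction_pair] by simp

lemma range_funpow_antimono: "m \<le> n \<Longrightarrow> range (T ^^ n) \<subseteq> range (T ^^ m)"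
  by (auto simp: funpow_add dest!: le_Suc_ex)

lemma in_range_iff: "x \<in> range (T ^^ n) \<longleftrightarrow> (T ^^ n) ((S ^^ n) x) = x"
proof
  show "x \<in> range (T ^^ n)" if "(T ^^ n) ((S ^^ n) x) = x"
    using that by (metis rangeI)
qed auto

text \<open>The projections \<open>T\<^sup>n T\<^sup>*\<^sup>n\<close> decrease, and a limit of them lies in all the ranges.\<close>

lemma adj_funpow_tendsto_0: "(\<lambda>n. (S ^^ n) x) \<longlonglongrightarrow> 0"
proof -
  define q where "q n = (T ^^ n) ((S ^^ n) x)" for n
  interpret n: contraction_pair "T ^^ n" "S ^^ n" for n by (rule funpow_contraction_pair)
  have norm_q: "norm (q n) = norm ((S ^^ n) x)" for n
    by (simp add: q_def funpow_isometry)
  have dec: "norm (q (Suc n)) \<le> norm (q n)" for n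
    using adj_norm_le by (simp add: norm_q)
  \<comment> \<open>\<open>q m\<close> is the projection of \<open>x\<close> onto the range of
    \<open>T ^^ m\<close>, which contains \<open>q n\<close>; so \<open>q m\<close> has the same
    inner product with \<open>q n\<close> as \<open>x\<close> has.\<close>
  have inner_q: "inner (q m) (q n) = (norm (q n))\<^sup>2" if "m \<le> n" for m n
  proof -
    have "q n \<in> range (T ^^ m)" using range_funpow_antimono[OF that] by (auto simp: q_def)
    then have "(T ^^ m) ((S ^^ m) (q n)) = q n" by (simp add: in_range_iff)
    then have "cinner (q m) (q n) = cinner x (q n)"
      by (simp add: q_def n.adj n.adj')
    also have "\<dots> = cinner (q n) (q n)" by (simp add: q_def n.adj n.adj')
    finally show ?thesis by (simp add: inner_Re_cinner cinner_self)
  qed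
  have diff_q: "(norm (q m - q n))\<^sup>2 = (norm (q m))\<^sup>2 - (norm (q n))\<^sup>2" if "m \<le> n" for m n
    using inner_q[OF that]
    by (simp add: power2_norm_eq_inner inner_diff_left inner_diff_right inner_commute)
  have "decseq (\<lambda>n. (norm (q n))\<^sup>2)"
    by (intro decseq_SucI power_mono dec) auto
  then have "Cauchy (\<lambda>n. (norm (q n))\<^sup>2)"
    by (metis decseq_convergent convergent_Cauchy convergent_def zero_le_power2)
  have "Cauchy q"
  proof (rule metric_CauchyI)
    fix e :: real assume e: "e > 0"
    obtain M where M: "\<And>m n. m \<ge> M \<Longrightarrow> n \<ge> M \<Longrightarrow> \<bar>(norm (q m))\<^sup>2 - (norm (q n))\<^sup>2\<bar> < e\<^sup>2"
      using metric_CauchyD[OF \<open>Cauchy (\<lambda>n. (norm (q n))\<^sup>2)\<close>, of "e\<^sup>2"] e by (auto simp: dist_real_def)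
    have "norm (q m - q n) < e" if "m \<ge> M" "n \<ge> M" for m n
    proof -
      have "(norm (q m - q n))\<^sup>2 < e\<^sup>2"
        using M[OF that] diff_q[of m n] diff_q[of n m] by (cases "m \<le> n") (auto simp: norm_minus_commute)
      then show ?thesis using e by (simp add: power2_less_imp_less)
    qed
    then show "\<exists>M. \<forall>m\<ge>M. \<forall>n\<ge>M. dist (q m) (q n) < e" by (auto simp: dist_norm)
  qed
  then obtain l where l: "q \<longlonglongrightarrow> l" using Cauchy_convergent convergent_def by blast
  \<comment> \<open>The range of \<open>T ^^ k\<close> is the fixed set of a continuous map, hence
    closed, and it contains \<open>q n\<close> for all \<open>n\<close> from \<open>k\<close>
    on.\<close>
  have "l \<in> range (T ^^ k)" for k
  proof -
    have "\<forall>\<^sub>F n in sequentially. (T ^^ k) ((S ^^ k) (q n)) = q n"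
      using eventually_ge_at_top[of k]
    proof eventually_elim
      case (elim n)
      then have "q n \<in> range (T ^^ k)" using range_funpow_antimono[OF elim] by (auto simp: q_def)
      then show ?case by (simp add: in_range_iff)
    qed
    moreover have "(\<lambda>n. (T ^^ k) ((S ^^ k) (q n))) \<longlonglongrightarrow> (T ^^ k) ((S ^^ k) l)"
      by (intro n.tendsto n.adjoint.tendsto l)
    ultimately have "q \<longlonglongrightarrow> (T ^^ k) ((S ^^ k) l)" by (rule Lim_transform_eventually[rotated])
    then show ?thesis using l LIMSEQ_unique by (auto simp: in_range_iff)
  qed
  then have "l = 0" using pure by blast
  then have "(\<lambda>n. norm (q n)) \<longlonglongrightarrow> 0" using tendsto_norm[OF l] by simp
  then show ?thesis unfolding norm_q by (rule tendsto_norm_zero_cancel)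
qed

text \<open>Moving the powers to the other side of the inner product reduces weak convergence to the
  strong convergence of the adjoint powers to 0.\<close>

lemma funpow_weakly_null: "weakly_null (\<lambda>n. (T ^^ n) x)"
  unfolding weakly_null_def
proof (intro conjI allI)
  show "\<exists>K. \<forall>n. norm ((T ^^ n) x) \<le> K" by (auto simp: funpow_isometry)
  fix y
  have "(\<lambda>n. cinner x ((S ^^ n) y)) \<longlonglongrightarrow> cinner x 0"
    by (intro tendsto_cinner_right adj_funpow_tendsto_0)
  then show "(\<lambda>n. cinner ((T ^^ n) x) y) \<longlonglongrightarrow> 0"
    by (simp add: contraction_pair.adj[OF funpow_contraction_pair])
qed

end

section \<open>Hausdorff moments and Bernstein sums\<close>

text \<open>For the moments of a measure on [0,1], this is the integral of
  \<open>t ^ j * (1 - t) ^ k\<close>.\<close>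

fun hausdorff_diff :: "(nat \<Rightarrow> real) \<Rightarrow> nat \<Rightarrow> nat \<Rightarrow> real" where
  "hausdorff_diff m j 0 = m j"
| "hausdorff_diff m j (Suc k) = hausdorff_diff m j k - hausdorff_diff m (Suc j) k"

lemma hausdorff_diff_shift: "hausdorff_diff (\<lambda>i. m (i + n)) j k = hausdorff_diff m (j + n) k"
  by (induction k arbitrary: j) auto

lemma hausdorff_diff_add:
  "hausdorff_diff (\<lambda>i. m i + m' i) j k = hausdorff_diff m j k + hausdorff_diff m' j k"
  by (induction k arbitrary: j) auto

lemma hausdorff_diff_mult:
  "hausdorff_diff (\<lambda>i. c * m i) j k = c * hausdorff_diff m j k"
  by (induction k arbitrary: j) (auto simp: algebra_simps)

text \<open>This is the partition of unity by the Bernstein polynomials of degree \<open>N\<close>,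
  multiplied by \<open>t ^ a * (1 - t) ^ c\<close> and integrated. Pascal's rule proves it for every
  sequence \<open>m\<close>, with \<open>a\<close> and \<open>c\<close> free because the induction
  step raises either of them.\<close>

lemma sum_binomial_hausdorff_diff:
  "(\<Sum>j\<le>N. real (N choose j) * hausdorff_diff m (a + j) (N - j + c)) = hausdorff_diff m a c"
proof (induction N arbitrary: a c)
  case (Suc N)
  define g where "g j = hausdorff_diff m (a + j) (Suc N - j + c)" for j
  have "(\<Sum>j\<le>Suc N. real (Suc N choose j) * g j)
      = g 0 + (\<Sum>j\<le>N. real (N choose Suc j) * g (Suc j)) + (\<Sum>j\<le>N. real (N choose j) * g (Suc j))"
    by (subst sum.atMost_Suc_shift) (simp add: sum.distrib[symmetric] algebra_simps)
  also have "g 0 + (\<Sum>j\<le>N. real (N choose Suc j) * g (Suc j)) = (\<Sum>j\<le>Suc N. real (N choose j) * g j)"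
    by (subst sum.atMost_Suc_shift) simp
  also have "\<dots> = (\<Sum>j\<le>N. real (N choose j) * hausdorff_diff m (a + j) (N - j + Suc c))"
    by (auto simp: g_def Suc_diff_le intro!: sum.cong)
  also have "\<dots> = hausdorff_diff m a (Suc c)" by (rule Suc)
  also have "(\<Sum>j\<le>N. real (N choose j) * g (Suc j))
      = (\<Sum>j\<le>N. real (N choose j) * hausdorff_diff m (Suc a + j) (N - j + c))"
    by (auto simp: g_def intro!: sum.cong)
  also have "\<dots> = hausdorff_diff m (Suc a) c" by (rule Suc)
  finally show ?case by (simp add: g_def)
qed simp

text \<open>The Bernstein polynomial of the identity function is the identity: the factor
  \<open>j / N\<close> turns \<open>N choose j\<close> into \<open>(N - 1) choose (j - 1)\<close>,
  leaving a partition of unity of degree one lower.\<close>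

lemma sum_binomial_hausdorff_diff_mean:
  assumes "N > 0"
  shows "(\<Sum>j\<le>N. (real j / real N) * (real (N choose j) * hausdorff_diff m j (N - j))) = m 1"
proof -
  obtain M where N: "N = Suc M" using assms by (cases N) auto
  have "real (Suc j) / real (Suc M) * real (Suc M choose Suc j) = real (M choose j)" for j
  proof -
    have "real (Suc j) * real (Suc M choose Suc j) = real (Suc M) * real (M choose j)"
      using Suc_times_binomial[of j M] by (simp only: of_nat_mult[symmetric])
    then show ?thesis by simp
  qed
  then have "(\<Sum>j\<le>N. (real j / real N) * (real (N choose j) * hausdorff_diff m j (N - j)))
      = (\<Sum>j\<le>M. real (M choose j) * hausdorff_diff m (1 + j) (M - j + 0))"
    unfolding N by (subst sum.atMost_Suc_shift) (simp add: mult.assoc[symmetric] del: of_nat_Suc binomial_Suc_Suc)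
  also have "\<dots> = m 1" using sum_binomial_hausdorff_diff[of M m 1 0] by simp
  finally show ?thesis .
qed

text \<open>Written multiplicatively, the ratio of the binomial weights at \<open>j\<close> in
  degree \<open>N\<close> and at \<open>j + n\<close> in degree \<open>N + n\<close>. It serves to
  compare the Bernstein sum of a shifted moment sequence with one for the original sequence.\<close>

lemma binomial_shift_prod:
  "real (N choose j) * (\<Prod>i<n. real (N + Suc i)) = real ((N + n) choose (j + n)) * (\<Prod>i<n. real (j + Suc i))"
proof (induction n)
  case (Suc n)
  have "real (Suc (j + n)) * real (Suc (N + n) choose Suc (j + n)) = real (Suc (N + n)) * real ((N + n) choose (j + n))"
    using Suc_times_binomial[of "j + n" "N + n"] by (simp only: of_nat_mult[symmetric])
  then have step: "real ((N + n) choose (j + n)) * real (N + Suc n)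
      = real ((N + Suc n) choose (j + Suc n)) * real (j + Suc n)"
    by (simp only: add_Suc_right mult.commute)
  have "real (N choose j) * (\<Prod>i<Suc n. real (N + Suc i))
      = (real (N choose j) * (\<Prod>i<n. real (N + Suc i))) * real (N + Suc n)"
    by (simp only: prod.lessThan_Suc mult.assoc)
  also have "\<dots> = (real ((N + n) choose (j + n)) * real (N + Suc n)) * (\<Prod>i<n. real (j + Suc i))"
    by (simp only: Suc.IH mult_ac)
  also have "\<dots> = real ((N + Suc n) choose (j + Suc n)) * (\<Prod>i<Suc n. real (j + Suc i))"
    by (simp only: step) (simp only: prod.lessThan_Suc mult_ac)
  finally show ?case .
qed simp

text \<open>When \<open>m\<close> is the moment sequence of a measure on \<open>[0,1]\<close>, this is Bernstein's approximation
  to the measure of \<open>[0,s]\<close>.\<close>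

definition bernstein_cdf :: "(nat \<Rightarrow> real) \<Rightarrow> real \<Rightarrow> nat \<Rightarrow> real" where
  "bernstein_cdf m s N =
     (\<Sum>j | j \<le> N \<and> real j \<le> s * real N. real (N choose j) * hausdorff_diff m j (N - j))"

lemma bernstein_cdf_add:
  "bernstein_cdf (\<lambda>i. m i + m' i) s N = bernstein_cdf m s N + bernstein_cdf m' s N"
  by (simp add: bernstein_cdf_def hausdorff_diff_add algebra_simps sum.distrib)

lemma bernstein_cdf_mult: "bernstein_cdf (\<lambda>i. c * m i) s N = c * bernstein_cdf m s N"
  by (simp add: bernstein_cdf_def hausdorff_diff_mult sum_distrib_left mult_ac)

context
  fixes m :: "nat \<Rightarrow> real"
  assumes nonneg: "\<And>j k. hausdorff_diff m j k \<ge> 0"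
begin

lemma bernstein_cdf_nonneg: "bernstein_cdf m s N \<ge> 0"
  unfolding bernstein_cdf_def by (intro sum_nonneg mult_nonneg_nonneg nonneg) auto

lemma bernstein_cdf_le: "bernstein_cdf m s N \<le> m 0"
proof -
  have "bernstein_cdf m s N \<le> (\<Sum>j\<le>N. real (N choose j) * hausdorff_diff m j (N - j))"
    unfolding bernstein_cdf_def by (intro sum_mono2 mult_nonneg_nonneg nonneg) auto
  then show ?thesis using sum_binomial_hausdorff_diff[of N m 0 0] by simp
qed

text \<open>In terms of a measure, the left side integrates \<open>1 - t\<close>, which is at most 1
  on \<open>[0,s]\<close> and at most \<open>1 - s\<close> beyond \<open>s\<close>; Bernstein sums
  obey the same split at \<open>j / N = s\<close>.\<close>

lemma bernstein_cdf_lower_bound: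
  assumes "N > 0" "s \<le> 1"
  shows "m 0 - m 1 \<le> bernstein_cdf m s N + (1 - s) * m 0"
proof -
  define b where "b j = real (N choose j) * hausdorff_diff m j (N - j)" for j
  have b: "b j \<ge> 0" for j unfolding b_def by (intro mult_nonneg_nonneg nonneg) auto
  have total: "(\<Sum>j\<le>N. b j) = m 0"
    using sum_binomial_hausdorff_diff[of N m 0 0] by (simp add: b_def)
  have "m 0 - m 1 = (\<Sum>j\<le>N. (1 - real j / real N) * b j)"
    using sum_binomial_hausdorff_diff_mean[OF assms(1), of m] total
    by (simp add: b_def left_diff_distrib sum_subtractf)
  also have "\<dots> \<le> (\<Sum>j\<le>N. (if real j \<le> s * real N then b j else 0) + (1 - s) * b j)"
  proof (rule sum_mono)
    fix j
    show "(1 - real j / real N) * b j \<le> (if real j \<le> s * real N then b j else 0) + (1 - s) * b j"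
    proof (cases "real j \<le> s * real N")
      case le: True
      have "(1 - real j / real N) * b j \<le> 1 * b j" by (intro mult_right_mono b) auto
      moreover have "(1 - s) * b j \<ge> 0" using assms(2) b by simp
      ultimately show ?thesis using le by simp
    next
      case False
      then have "s \<le> real j / real N" using assms(1) by (simp add: pos_le_divide_eq)
      then have "(1 - real j / real N) * b j \<le> (1 - s) * b j" by (intro mult_right_mono b) auto
      then show ?thesis using False by simp
    qed
  qed
  also have "\<dots> = bernstein_cdf m s N + (1 - s) * m 0"
  proof -
    have "(\<Sum>j\<le>N. if real j \<le> s * real N then b j else 0) = bernstein_cdf m s N"
      unfolding bernstein_cdf_def b_def
      by (subst sum.inter_filter[symmetric]) (auto intro!: sum.cong)
    then show ?thesis by (simp add: sum.distrib total sum_distrib_left[symmetric])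
  qed
  finally show ?thesis .
qed

text \<open>Shifting by \<open>n\<close> multiplies the measure by \<open>t ^ n\<close>, which is at
  most \<open>s ^ n\<close> on \<open>[0,s]\<close>. The product is the discrete substitute for
  \<open>s ^ n\<close> and tends to it as \<open>N\<close> grows.\<close>

lemma bernstein_cdf_shift_le:
  assumes "s \<ge> 0"
  shows "bernstein_cdf (\<lambda>i. m (i + n)) s N \<le> (\<Prod>i<n. (s * real N + real (Suc i)) / real (N + Suc i)) * m 0"
proof -
  define P where "P = (\<Prod>i<n. (s * real N + real (Suc i)) / real (N + Suc i))"
  have P: "P \<ge> 0" unfolding P_def using assms by (intro prod_nonneg) auto
  define J where "J = {j. j \<le> N \<and> real j \<le> s * real N}"
  define h where "h j = real ((N + n) choose j) * hausdorff_diff m j (N + n - j)" for j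
  have h: "h j \<ge> 0" for j unfolding h_def by (intro mult_nonneg_nonneg nonneg) auto
  have "real (N choose j) * hausdorff_diff m (j + n) (N - j) \<le> P * h (j + n)" if "j \<in> J" for j
  proof -
    have pos: "(\<Prod>i<n. real (N + Suc i)) > 0" by (intro prod_pos) auto
    have "real (N choose j) = real ((N + n) choose (j + n)) * (\<Prod>i<n. real (j + Suc i)) / (\<Prod>i<n. real (N + Suc i))"
      using binomial_shift_prod[of N j n] pos by (simp add: eq_divide_eq)
    also have "\<dots> = real ((N + n) choose (j + n)) * (\<Prod>i<n. real (j + Suc i) / real (N + Suc i))"
      by (simp add: prod_dividef)
    also have "\<dots> \<le> real ((N + n) choose (j + n)) * P"
      unfolding P_def using that
      by (intro mult_left_mono prod_mono) (auto simp: J_def intro!: divide_right_mono)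
    finally have "real (N choose j) * hausdorff_diff m (j + n) (N - j)
        \<le> (real ((N + n) choose (j + n)) * P) * hausdorff_diff m (j + n) (N - j)"
      by (rule mult_right_mono) (rule nonneg)
    then show ?thesis by (simp add: h_def mult_ac)
  qed
  then have "bernstein_cdf (\<lambda>i. m (i + n)) s N \<le> (\<Sum>j\<in>J. P * h (j + n))"
    unfolding bernstein_cdf_def hausdorff_diff_shift J_def[symmetric] by (rule sum_mono)
  also have "\<dots> = P * (\<Sum>j\<in>(\<lambda>j. j + n) ` J. h j)"
    by (subst sum.reindex) (auto simp: sum_distrib_left)
  also have "\<dots> \<le> P * (\<Sum>j\<le>N + n. h j)"
    by (intro mult_left_mono P sum_mono2 h) (auto simp: J_def)
  also have "(\<Sum>j\<le>N + n. h j) = m 0"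
    using sum_binomial_hausdorff_diff[of "N + n" m 0 0] by (simp add: h_def)
  finally show ?thesis unfolding P_def .
qed

end

lemma psd_form_triangle:
  fixes b :: "'a::real_vector \<Rightarrow> 'a \<Rightarrow> real"
  assumes add: "\<And>f g h. b (f + g) h = b f h + b g h"
    and scale: "\<And>c f h. b (c *\<^sub>R f) h = c * b f h"
    and sym: "\<And>f g. b f g = b g f"
    and nonneg: "\<And>f. b f f \<ge> 0"
  shows "sqrt (b (f + g) (f + g)) \<le> sqrt (b f f) + sqrt (b g g)"
proof -
  have add': "b h (f + g) = b h f + b h g" for f g h using add[of f g h] sym by metis
  have scale': "b h (c *\<^sub>R f) = c * b h f" for c f h using scale[of c f h] sym by metis
  have expand: "0 \<le> b f f + 2 * t * b f g + t\<^sup>2 * b g g" for t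
    using nonneg[of "f + t *\<^sub>R g"] sym[of g f]
    by (simp add: add add' scale scale' power2_eq_square algebra_simps)
  have cs: "(b f g)\<^sup>2 \<le> b f f * b g g"
  proof (cases "b g g = 0")
    case True
    have "b f g = 0"
    proof (rule ccontr)
      assume "b f g \<noteq> 0"
      then have "2 * (- (b f f + 1) / (2 * b f g)) * b f g = - (b f f + 1)" by simp
      then show False using expand[of "- (b f f + 1) / (2 * b f g)"] True by simp
    qed
    then show ?thesis using True by simp
  next
    case False
    then have pos: "b g g > 0" using nonneg[of g] by simp
    have "0 \<le> b f f - (b f g)\<^sup>2 / b g g"
      using expand[of "- b f g / b g g"] pos by (simp add: power2_eq_square field_simps)
    then show ?thesis using pos by (simp add: field_simps)
  qed
  have "b f g \<le> sqrt (b f f) * sqrt (b g g)"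
    using real_le_rsqrt[OF cs] by (simp add: real_sqrt_mult)
  then have "b (f + g) (f + g) \<le> (sqrt (b f f) + sqrt (b g g))\<^sup>2"
    using nonneg[of f] nonneg[of g] sym[of g f] by (simp add: add add' power2_sum)
  then show ?thesis using nonneg by (intro real_le_lsqrt) auto
qed

section \<open>Essentially normal contractions commuting with a pure isometry\<close>

context contraction_pair
begin

text \<open>\<open>T\<close> commutes with \<open>S\<close> modulo compact operators, hence with
  every power of \<open>S\<close>; since \<open>S ^^ i\<close> preserves weakly null sequences, each
  compact error vanishes along them.\<close>

lemma commutator_weakly_null:
  assumes C: "compact_operator (\<lambda>x. S (T x) - T (S x))" and x: "weakly_null x"
  shows "(\<lambda>n. T ((S ^^ i) (x n)) - (S ^^ i) (T (x n))) \<longlonglongrightarrow> 0"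
  using x
proof (induction i arbitrary: x)
  case (Suc i)
  interpret i: contraction_pair "T ^^ i" "S ^^ i" by (rule funpow_contraction_pair)
  define y where "y n = (S ^^ i) (x n)" for n
  have y: "weakly_null y" unfolding y_def using i.adjoint.weakly_null_image[OF Suc.prems] .
  \<comment> \<open>The self-commutator is its own adjoint, so it serves as
    \<open>D\<close>.\<close>
  have "(\<lambda>n. S (T (y n)) - T (S (y n))) \<longlonglongrightarrow> 0"
    by (rule compact_operator_weakly_null[OF C _ y, of "\<lambda>x. S (T x) - T (S x)"])
       (simp add: cinner_diff_left cinner_diff_right adj adj')
  moreover have "(\<lambda>n. S (T (y n) - (S ^^ i) (T (x n)))) \<longlonglongrightarrow> S 0"
    unfolding y_def by (intro adjoint.tendsto Suc.IH Suc.prems)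
  ultimately have "(\<lambda>n. S (T (y n) - (S ^^ i) (T (x n))) - (S (T (y n)) - T (S (y n)))) \<longlonglongrightarrow> S 0 - 0"
    by (intro tendsto_diff)
  then show ?case by (simp add: y_def adjoint.diff)
qed simp

text \<open>Regrouping a power of the product of \<open>S\<close> and \<open>T\<close> into separate
  powers only moves \<open>T\<close> past powers of \<open>S\<close>, at the cost of errors that
  vanish along weakly null sequences.\<close>

lemma funpow_asymptotically_normal:
  assumes C: "compact_operator (\<lambda>x. S (T x) - T (S x))" and x: "weakly_null x"
  shows "(\<lambda>n. ((\<lambda>x. S (T x)) ^^ i) (x n) - (S ^^ i) ((T ^^ i) (x n))) \<longlonglongrightarrow> 0"
proof (induction i)
  case (Suc i)
  interpret i: contraction_pair "T ^^ i" "S ^^ i" by (rule funpow_contraction_pair)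
  define y where "y n = (T ^^ i) (x n)" for n
  have y: "weakly_null y" unfolding y_def by (rule i.weakly_null_image[OF x])
  have "(\<lambda>n. S (T (((\<lambda>x. S (T x)) ^^ i) (x n) - (S ^^ i) (y n))) + S (T ((S ^^ i) (y n)) - (S ^^ i) (T (y n))))
      \<longlonglongrightarrow> S (T 0) + S 0"
    unfolding y_def
    by (intro tendsto_add adjoint.tendsto tendsto Suc commutator_weakly_null[OF C y, unfolded y_def])
  then show ?case by (simp add: y_def adjoint.diff diff funpow_swap1)
qed simp

end

section \<open>Moments of a contraction along the orbits of a commuting isometry\<close>

locale essentially_normal_with_isometry =
  contraction_pair T T' + U: pure_isometry U U' for T T' U U' :: "'a::complex_hilbert_space \<Rightarrow> 'a" +
  assumes commute: "T (U x) = U (T x)"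
    and compact_commutator: "compact_operator (\<lambda>x. T' (T x) - T (T' x))"
begin

lemma funpow_commute: "(T ^^ i) ((U ^^ n) x) = (U ^^ n) ((T ^^ i) x)"
proof -
  have "T ((U ^^ n) x) = (U ^^ n) (T x)" for x
    by (induction n) (simp_all add: commute)
  then show ?thesis by (induction i) simp_all
qed

definition defect :: "'a \<Rightarrow> 'a" where "defect x = x - T' (T x)"

lemma defect_adj: "inner ((defect ^^ k) x) y = inner x ((defect ^^ k) y)"
proof -
  have "inner (defect x) y = inner x (defect y)" for x y
    by (simp add: defect_def inner_Re_cinner cinner_diff_left cinner_diff_right adj adj')
  then show ?thesis
    by (induction k arbitrary: x y) (simp_all add: funpow_swap1)
qed

lemma defect_diff: "(defect ^^ k) (x - y) = (defect ^^ k) x - (defect ^^ k) y"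
  by (induction k) (simp_all add: defect_def diff adjoint.diff)

text \<open>For even \<open>k\<close> the operator is the square of a selfadjoint one. For odd
  \<open>k\<close> one factor remains in the middle, and it is positive because \<open>T\<close> is
  a contraction.\<close>

lemma defect_nonneg: "0 \<le> inner ((defect ^^ k) x) x"
proof -
  obtain l where "k = l + l \<or> k = Suc (l + l)"
    by (metis add_2_eq_Suc' evenE mult_2 oddE Suc_eq_plus1)
  moreover have "inner ((defect ^^ (l + l)) x) x \<ge> 0"
    using defect_adj[of l "(defect ^^ l) x" x] by (simp add: funpow_add)
  moreover have "inner ((defect ^^ Suc (l + l)) x) x \<ge> 0"
  proof -
    have "inner ((defect ^^ Suc (l + l)) x) x = inner (defect ((defect ^^ l) x)) ((defect ^^ l) x)"
      using defect_adj[of l "defect ((defect ^^ l) x)" x] by (simp add: funpow_add funpow_swap1)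
    also have "\<dots> = (norm ((defect ^^ l) x))\<^sup>2 - (norm (T ((defect ^^ l) x)))\<^sup>2"
      by (simp add: defect_def[of "(defect ^^ l) x"] inner_Re_cinner cinner_diff_left adj' cinner_self)
    finally show ?thesis using norm_le by (simp add: power_mono)
  qed
  ultimately show ?thesis by blast
qed

text \<open>On the diagonal these are the squared norms of \<open>(T ^^ i) f\<close>; the
  two-argument form lets the triangle inequality for the cutoff seminorm use bilinearity.\<close>

definition moments :: "'a \<Rightarrow> 'a \<Rightarrow> nat \<Rightarrow> real" where
  "moments f g i = inner ((T ^^ i) f) ((T ^^ i) g)"

text \<open>Along the weakly null orbit of \<open>U\<close>, the powers of \<open>T' T\<close> have
  the quadratic forms \<open>moments f f\<close> in the limit, and factors of \<open>defect\<close>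
  become differences of them.\<close>

lemma tendsto_hausdorff_diff:
  "(\<lambda>n. inner ((defect ^^ k) (((\<lambda>x. T' (T x)) ^^ j) ((U ^^ n) f))) ((U ^^ n) f))
     \<longlonglongrightarrow> hausdorff_diff (moments f f) j k"
proof (induction k arbitrary: j)
  case 0
  interpret j: contraction_pair "T ^^ j" "T' ^^ j" by (rule funpow_contraction_pair)
  let ?d = "\<lambda>n. ((\<lambda>x. T' (T x)) ^^ j) ((U ^^ n) f) - (T' ^^ j) ((T ^^ j) ((U ^^ n) f))"
  have "?d \<longlonglongrightarrow> 0"
    by (rule funpow_asymptotically_normal[OF compact_commutator U.funpow_weakly_null])
  have "(\<lambda>n. inner (?d n) ((U ^^ n) f)) \<longlonglongrightarrow> 0"
  proof (rule Lim_null_comparison)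
    show "\<forall>\<^sub>F n in sequentially. norm (inner (?d n) ((U ^^ n) f)) \<le> norm (?d n) * norm f"
      using Cauchy_Schwarz_ineq2[of "?d _" "(U ^^ _) f"] by (simp add: U.funpow_isometry)
    show "(\<lambda>n. norm (?d n) * norm f) \<longlonglongrightarrow> 0"
      using tendsto_mult_left_zero[OF tendsto_norm_zero[OF \<open>?d \<longlonglongrightarrow> 0\<close>]] .
  qed
  \<comment> \<open>This value does not depend on \<open>n\<close>, since \<open>U\<close> commutes
    with \<open>T\<close> and preserves inner products.\<close>
  moreover have "inner ((T' ^^ j) ((T ^^ j) ((U ^^ n) f))) ((U ^^ n) f) = moments f f j" for n
    by (simp add: moments_def inner_Re_cinner j.adj' funpow_commute U.cinner_funpow)
  ultimately have "(\<lambda>n. inner (((\<lambda>x. T' (T x)) ^^ j) ((U ^^ n) f)) ((U ^^ n) f) - moments f f j) \<longlonglongrightarrow> 0"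
    by (simp add: inner_diff_left)
  then show ?case by (simp add: LIM_zero_iff)
next
  case (Suc k)
  \<comment> \<open>With \<open>A = T' T\<close> and \<open>defect = 1 - A\<close>, peeling off one
    factor reproduces the recursion of \<open>hausdorff_diff\<close>.\<close>
  have "(defect ^^ Suc k) (((\<lambda>x. T' (T x)) ^^ j) x)
      = (defect ^^ k) (((\<lambda>x. T' (T x)) ^^ j) x) - (defect ^^ k) (((\<lambda>x. T' (T x)) ^^ Suc j) x)" for x
    unfolding defect_diff[symmetric] by (simp add: funpow_swap1[of defect] defect_def[of "((\<lambda>x. T' (T x)) ^^ j) x"])
  then show ?case using tendsto_diff[OF Suc[of j] Suc[of "Suc j"]] by (simp add: inner_diff_left)
qed

lemma moments_shift: "moments ((T ^^ n) f) ((T ^^ n) f) = (\<lambda>i. moments f f (i + n))"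
  by (simp add: fun_eq_iff moments_def funpow_add)

text \<open>For \<open>j = 0\<close> the approximating quadratic forms are those of powers of
  \<open>defect\<close>, hence nonnegative. The general case replaces \<open>f\<close> by
  \<open>(T ^^ j) f\<close>, which shifts the moments by \<open>j\<close>.\<close>

lemma hausdorff_diff_moments_nonneg: "0 \<le> hausdorff_diff (moments f f) j k"
proof -
  have "0 \<le> hausdorff_diff (moments g g) 0 k" for g
    by (rule LIMSEQ_le_const[OF tendsto_hausdorff_diff]) (simp add: defect_nonneg)
  from this[of "(T ^^ j) f"] show ?thesis
    unfolding moments_shift hausdorff_diff_shift by simp
qed

text \<open>Approximates, as \<open>N\<close> grows, the norm of the component of \<open>f\<close> in the spectral subspace
  \<open>|z|\<^sup>2 \<le> s\<close> of the normal extension of \<open>T\<close>.\<close>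

definition cutoff_norm :: "real \<Rightarrow> nat \<Rightarrow> 'a \<Rightarrow> real" where
  "cutoff_norm s N f = sqrt (bernstein_cdf (moments f f) s N)"

lemma cutoff_norm_triangle: "cutoff_norm s N (f + g) \<le> cutoff_norm s N f + cutoff_norm s N g"
  unfolding cutoff_norm_def
proof (rule psd_form_triangle[of "\<lambda>f g. bernstein_cdf (moments f g) s N"])
  interpret n: contraction_pair "T ^^ n" "T' ^^ n" for n by (rule funpow_contraction_pair)
  fix f g h :: 'a and c :: real
  have "moments (f + g) h = (\<lambda>i. moments f h i + moments g h i)"
    by (simp add: fun_eq_iff moments_def inner_add_left)
  then show "bernstein_cdf (moments (f + g) h) s N = bernstein_cdf (moments f h) s N + bernstein_cdf (moments g h) s N"
    by (simp add: bernstein_cdf_add)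
  have "moments (c *\<^sub>R f) h = (\<lambda>i. c * moments f h i)"
    by (simp add: fun_eq_iff moments_def linear_simps(5)[OF n.bounded_linear])
  then show "bernstein_cdf (moments (c *\<^sub>R f) h) s N = c * bernstein_cdf (moments f h) s N"
    by (simp add: bernstein_cdf_mult)
  have "moments f g = moments g f" by (simp add: fun_eq_iff moments_def inner_commute)
  then show "bernstein_cdf (moments f g) s N = bernstein_cdf (moments g f) s N" by simp
  show "0 \<le> bernstein_cdf (moments f f) s N"
    by (simp add: bernstein_cdf_nonneg hausdorff_diff_moments_nonneg)
qed

lemma cutoff_norm_le: "cutoff_norm s N f \<le> norm f"
  using bernstein_cdf_le[OF hausdorff_diff_moments_nonneg, of f s N]
  by (simp add: cutoff_norm_def moments_def norm_eq_sqrt_inner)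

lemma cutoff_norm_U: "cutoff_norm s N ((U ^^ n) f) = cutoff_norm s N f"
proof -
  have "moments ((U ^^ n) f) ((U ^^ n) f) = moments f f"
    by (simp add: fun_eq_iff moments_def funpow_commute inner_Re_cinner U.cinner_funpow)
  then show ?thesis by (simp add: cutoff_norm_def)
qed

text \<open>\<open>limsup\<^sub>N cutoff_norm s N f \<le> t\<close>\<close>

definition cutoff_le :: "real \<Rightarrow> 'a \<Rightarrow> real \<Rightarrow> bool" where
  "cutoff_le s f t \<longleftrightarrow> (\<forall>\<epsilon>>0. \<forall>\<^sub>F N in sequentially. cutoff_norm s N f \<le> t + \<epsilon>)"

lemma cutoff_le_norm: "cutoff_le s f (norm f)"
  unfolding cutoff_le_def using cutoff_norm_le by (auto intro!: always_eventually intro: add_increasing2)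

lemma cutoff_le_U: "cutoff_le s ((U ^^ n) f) t \<Longrightarrow> cutoff_le s f t"
  by (simp add: cutoff_le_def cutoff_norm_U)

lemma cutoff_le_add:
  assumes "cutoff_le s f t" "cutoff_le s g u"
  shows "cutoff_le s (f + g) (t + u)"
  unfolding cutoff_le_def
proof (intro allI impI)
  fix \<epsilon> :: real assume "\<epsilon> > 0"
  then have "\<forall>\<^sub>F N in sequentially. cutoff_norm s N f \<le> t + \<epsilon> / 2"
    "\<forall>\<^sub>F N in sequentially. cutoff_norm s N g \<le> u + \<epsilon> / 2"
    using assms unfolding cutoff_le_def by (meson half_gt_zero)+
  then show "\<forall>\<^sub>F N in sequentially. cutoff_norm s N (f + g) \<le> t + u + \<epsilon>"
    by eventually_elim (use cutoff_norm_triangle[of s _ f g] in \<open>smt (verit) field_sum_of_halves\<close>)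
qed

lemma cutoff_le_sum:
  "finite I \<Longrightarrow> (\<And>i. i \<in> I \<Longrightarrow> cutoff_le s (f i) (t i)) \<Longrightarrow> cutoff_le s (\<Sum>i\<in>I. f i) (\<Sum>i\<in>I. t i)"
proof (induction I rule: finite_induct)
  case empty
  show ?case using cutoff_le_norm[of s 0] by simp
qed (simp add: cutoff_le_add)

lemma cutoff_le_mono: "cutoff_le s f t \<Longrightarrow> t \<le> u \<Longrightarrow> cutoff_le s f u"
  unfolding cutoff_le_def by (meson add_right_mono eventually_mono order_trans)

lemma cutoff_le_limit:
  assumes le: "\<And>k. cutoff_le s f (t k)" and t: "t \<longlonglongrightarrow> u"
  shows "cutoff_le s f u"
  unfolding cutoff_le_def
proof (intro allI impI)
  fix \<epsilon> :: real assume "\<epsilon> > 0"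
  then obtain k where k: "t k < u + \<epsilon> / 2"
    using order_tendstoD(2)[OF t, of "u + \<epsilon> / 2"] by (auto dest: eventually_happens'[rotated])
  have "\<forall>\<^sub>F N in sequentially. cutoff_norm s N f \<le> t k + \<epsilon> / 2"
    using le[of k] \<open>\<epsilon> > 0\<close> unfolding cutoff_le_def by (meson half_gt_zero)
  then show "\<forall>\<^sub>F N in sequentially. cutoff_norm s N f \<le> u + \<epsilon>"
    by eventually_elim (use k in simp)
qed

text \<open>On the spectral part below \<open>s\<close>, each application of \<open>T\<close>
  multiplies norms by at most \<open>sqrt s\<close>; for finite \<open>N\<close> the total factor is
  the square root of the product \<open>P N\<close>, which tends to \<open>s ^ n\<close>.\<close>

lemma cutoff_le_funpow:
  assumes "s \<ge> 0"
  shows "cutoff_le s ((T ^^ n) f) (sqrt s ^ n * norm f)"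
  unfolding cutoff_le_def
proof (intro allI impI)
  fix \<epsilon> :: real assume \<epsilon>: "\<epsilon> > 0"
  define P where "P N = (\<Prod>i<n. (s * real N + real (Suc i)) / real (N + Suc i))" for N
  have "P \<longlonglongrightarrow> (\<Prod>i<n. s)"
    unfolding P_def
  proof (rule tendsto_prod)
    fix i
    show "(\<lambda>N. (s * real N + real (Suc i)) / real (N + Suc i)) \<longlonglongrightarrow> s"
      by real_asymp
  qed
  then have "(\<lambda>N. sqrt (P N) * norm f) \<longlonglongrightarrow> sqrt (s ^ n) * norm f"
    by (intro tendsto_intros) simp
  then have "\<forall>\<^sub>F N in sequentially. sqrt (P N) * norm f < sqrt (s ^ n) * norm f + \<epsilon>"
    using \<epsilon> by (intro order_tendstoD(2)) auto
  then show "\<forall>\<^sub>F N in sequentially. cutoff_norm s N ((T ^^ n) f) \<le> sqrt s ^ n * norm f + \<epsilon>"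
  proof eventually_elim
    case (elim N)
    have "cutoff_norm s N ((T ^^ n) f) \<le> sqrt (P N * moments f f 0)"
      unfolding cutoff_norm_def moments_shift P_def
      by (intro real_sqrt_le_mono bernstein_cdf_shift_le hausdorff_diff_moments_nonneg assms)
    also have "\<dots> = sqrt (P N) * norm f"
      by (simp add: real_sqrt_mult moments_def norm_eq_sqrt_inner)
    finally show ?case using elim by (simp add: real_sqrt_power)
  qed
qed

text \<open>Letting \<open>N\<close> grow in the Bernstein lower bound removes the cutoff term and
  leaves \<open>(1 - s) * (norm f)\<^sup>2\<close> as the only possible loss of norm; then
  \<open>s\<close> tends to 1.\<close>

lemma isometry_if_cutoff_le_0:
  assumes "\<And>s f. 0 < s \<Longrightarrow> s < 1 \<Longrightarrow> cutoff_le s f 0"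
  shows "norm (T f) = norm f"
proof -
  have le: "(norm f)\<^sup>2 - (norm (T f))\<^sup>2 \<le> (1 - s) * (norm f)\<^sup>2" if s: "0 < s" "s < 1" for s
  proof (rule field_le_epsilon)
    fix \<epsilon> :: real assume \<epsilon>: "\<epsilon> > 0"
    have "\<forall>\<^sub>F N in sequentially. cutoff_norm s N f \<le> 0 + sqrt \<epsilon>"
      using assms[OF s, of f] \<epsilon> unfolding cutoff_le_def by simp
    then have "\<forall>\<^sub>F N in sequentially. cutoff_norm s N f \<le> sqrt \<epsilon> \<and> N > 0"
      using eventually_gt_at_top[of 0] by eventually_elim simp
    then obtain N where N: "cutoff_norm s N f \<le> sqrt \<epsilon>" "N > 0"
      by (auto dest: eventually_happens'[rotated])
    have "bernstein_cdf (moments f f) s N \<le> \<epsilon>" using N(1) by (simp add: cutoff_norm_def)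
    then show "(norm f)\<^sup>2 - (norm (T f))\<^sup>2 \<le> (1 - s) * (norm f)\<^sup>2 + \<epsilon>"
      using bernstein_cdf_lower_bound[OF hausdorff_diff_moments_nonneg, of N s f] N(2) s
      by (simp add: moments_def power2_norm_eq_inner)
  qed
  have "(norm f)\<^sup>2 - (norm (T f))\<^sup>2 \<le> (1 - 1) * (norm f)\<^sup>2"
  proof (rule tendsto_le[of "at_left (1::real)"])
    show "((\<lambda>s. (1 - s) * (norm f)\<^sup>2) \<longlongrightarrow> (1 - 1) * (norm f)\<^sup>2) (at_left 1)"
      by (intro tendsto_intros)
    show "\<forall>\<^sub>F s in at_left 1. (norm f)\<^sup>2 - (norm (T f))\<^sup>2 \<le> (1 - s) * (norm f)\<^sup>2"
      using le eventually_at_left_real[of 0 "1::real"] by (auto elim: eventually_mono)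
  qed auto
  then have "norm f \<le> norm (T f)" by simp
  then show ?thesis using norm_le[of f] by simp
qed

end

section \<open>Modules determined by Taylor coefficients\<close>

definition module_poly ::
    "('a \<Rightarrow> 'a) \<Rightarrow> ('m::finite \<Rightarrow> 'a::complex_hilbert_space) \<Rightarrow> nat \<Rightarrow> (nat \<Rightarrow> 'm \<Rightarrow> complex) \<Rightarrow> 'a" where
  "module_poly T e L c = (\<Sum>n<L. \<Sum>i\<in>UNIV. c n i *\<^sub>C (T ^^ n) (e i))"

lemma module_poly_tendsto:
  assumes "\<And>x \<epsilon>. \<epsilon> > 0 \<Longrightarrow> \<exists>L c. norm (x - module_poly T e L c) < \<epsilon>"
  obtains L c where "(\<lambda>k. module_poly T e (L k) (c k)) \<longlonglongrightarrow> x"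
proof -
  have "\<exists>L c. norm (x - module_poly T e L c) < 1 / real (Suc k)" for k
    by (rule assms) simp
  then obtain L c where Lc: "\<And>k. norm (x - module_poly T e (L k) (c k)) < 1 / real (Suc k)"
    by metis
  have "(\<lambda>k. module_poly T e (L k) (c k) - x) \<longlonglongrightarrow> 0"
    by (rule Lim_null_comparison[OF _ LIMSEQ_Suc[OF lim_1_over_n]])
       (intro always_eventually allI, subst norm_minus_commute, rule less_imp_le[OF Lc])
  then show ?thesis using that LIM_zero_iff by blast
qed

text \<open>The vectors \<open>\<kappa> n i\<close> represent the Taylor coefficients at the origin of the elements of a
  module generated by the vectors \<open>e i\<close>.\<close>

locale taylor_module =
  contraction_pair T T' for T T' :: "'a::complex_hilbert_space \<Rightarrow> 'a" +
  fixes e :: "'m::finite \<Rightarrow> 'a" and \<kappa> :: "nat \<Rightarrow> 'm \<Rightarrow> 'a"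
  assumes polynomials_dense: "\<And>x \<epsilon>. \<epsilon> > 0 \<Longrightarrow> \<exists>L c. norm (x - module_poly T e L c) < \<epsilon>"
    and cinner_generator: "\<And>n i l j. cinner ((T ^^ n) (e i)) (\<kappa> l j) = (if n = l \<and> i = j then 1 else 0)"
    and coefficient_growth: "\<And>\<rho>. 0 < \<rho> \<Longrightarrow> \<rho> < 1 \<Longrightarrow> \<exists>C. \<forall>n i. norm (\<kappa> n i) \<le> C / \<rho> ^ n"
    and coefficients_determine: "\<And>x. (\<And>n i. cinner x (\<kappa> n i) = 0) \<Longrightarrow> x = 0"
begin

abbreviation polynomial :: "nat \<Rightarrow> (nat \<Rightarrow> 'm \<Rightarrow> complex) \<Rightarrow> 'a" where
  "polynomial \<equiv> module_poly T e"

lemma cinner_polynomial: "cinner (polynomial L c) (\<kappa> l j) = (if l < L then c l j else 0)"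
proof -
  have "cinner (polynomial L c) (\<kappa> l j)
      = (\<Sum>n<L. \<Sum>i\<in>UNIV. if i = j then (if n = l then c n i else 0) else 0)"
    unfolding module_poly_def cinner_sum_left cinner_scaleC_left cinner_generator
    by (intro sum.cong refl) simp
  then show ?thesis by simp
qed

lemma summable_coefficient_norms:
  assumes "0 < r" "r < 1"
  shows "summable (\<lambda>n. r ^ n * (\<Sum>i\<in>UNIV. w i * norm (\<kappa> n i)))"
proof -
  obtain \<rho> where \<rho>: "r < \<rho>" "\<rho> < 1" using assms dense by blast
  then obtain C where C: "\<And>n i. norm (\<kappa> n i) \<le> C / \<rho> ^ n"
    using coefficient_growth[of \<rho>] assms by auto
  have "summable (\<lambda>n. (r / \<rho>) ^ n * (C * (\<Sum>i\<in>(UNIV::'m set). \<bar>w i\<bar>)))"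
    using \<rho> assms by (intro summable_mult2 summable_geometric) auto
  then show ?thesis
  proof (rule summable_comparison_test'[where N=0])
    fix n
    have "norm (\<Sum>i\<in>UNIV. w i * norm (\<kappa> n i)) \<le> (\<Sum>i\<in>UNIV. \<bar>w i\<bar> * (C / \<rho> ^ n))"
      by (intro order_trans[OF norm_sum] sum_mono) (simp add: abs_mult mult_left_mono C del: times_divide_eq_right)
    then have "norm (r ^ n * (\<Sum>i\<in>UNIV. w i * norm (\<kappa> n i))) \<le> r ^ n * (\<Sum>i\<in>UNIV. \<bar>w i\<bar> * (C / \<rho> ^ n))"
      using assms by (simp add: abs_mult mult_left_mono)
    also have "\<dots> = (r / \<rho>) ^ n * (C * (\<Sum>i\<in>(UNIV::'m set). \<bar>w i\<bar>))"
      by (simp add: sum_distrib_right[symmetric] sum_divide_distrib[symmetric] power_divide)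
    finally show "norm (r ^ n * (\<Sum>i\<in>UNIV. w i * norm (\<kappa> n i)))
        \<le> (r / \<rho>) ^ n * (C * (\<Sum>i\<in>(UNIV::'m set). \<bar>w i\<bar>))" .
  qed
qed

text \<open>On polynomials, \<open>T ^^ k\<close> moves all coefficients up by \<open>k\<close>,
  leaving none below; density and continuity extend this to all \<open>x\<close>.\<close>

lemma coefficient_funpow_eq_0:
  assumes "n < k"
  shows "cinner ((T ^^ k) x) (\<kappa> n i) = 0"
proof -
  interpret k: contraction_pair "T ^^ k" "T' ^^ k" by (rule funpow_contraction_pair)
  obtain L c where lim: "(\<lambda>l. polynomial (L l) (c l)) \<longlonglongrightarrow> x" by (rule module_poly_tendsto[OF polynomials_dense])
  have "cinner ((T ^^ k) (polynomial (L l) (c l))) (\<kappa> n i) = 0" for l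
    using assms
    by (auto simp: module_poly_def k.sum cinner_sum_left cinner_scaleC_left
        funpow_add[symmetric, unfolded o_def fun_eq_iff, rule_format] cinner_generator)
  moreover have "(\<lambda>l. cinner ((T ^^ k) (polynomial (L l) (c l))) (\<kappa> n i)) \<longlonglongrightarrow> cinner ((T ^^ k) x) (\<kappa> n i)"
    by (intro tendsto_cinner_left k.tendsto lim)
  ultimately show ?thesis by (simp add: LIMSEQ_const_iff)
qed

text \<open>An element of all the ranges has all Taylor coefficients zero, and the coefficients
  determine the element.\<close>

lemma pure: "(\<Inter>k::nat. range (T ^^ k)) = {0}"
proof -
  have "x = 0" if x: "\<And>k. x \<in> range (T ^^ k)" for x
  proof (rule coefficients_determine)
    show "cinner x (\<kappa> n i) = 0" for n i
      using x[of "Suc n"] coefficient_funpow_eq_0[of n "Suc n"] by auto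
  qed
  moreover have "0 \<in> range (T ^^ k)" for k
    by (rule image_eqI[where x=0]) (auto simp: contraction_pair.zero[OF funpow_contraction_pair])
  ultimately show ?thesis by (auto intro!: equalityI)
qed

end

locale essentially_normal_taylor_module =
  essentially_normal_with_isometry T T' U U' + taylor_module T T' e \<kappa>
  for T T' U U' :: "'a::complex_hilbert_space \<Rightarrow> 'a" and e :: "'m::finite \<Rightarrow> 'a" and \<kappa>
begin

text \<open>The cutoff seminorm is dominated by a weighted sum of Taylor coefficients. It does not
  change under \<open>U\<close>, whereas each coefficient of \<open>(U ^^ k) f\<close> tends to 0
  under a summable majorant, so the seminorm vanishes for every \<open>s < 1\<close>.\<close>

lemma isometry: "norm (T f) = norm f"
proof (rule isometry_if_cutoff_le_0)
  fix s :: real and f :: 'a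
  assume s: "0 < s" "s < 1"
  define r where "r = sqrt s"
  have r: "0 < r" "r < 1" using s by (auto simp: r_def)
  define K where "K n = r ^ n * (\<Sum>i\<in>UNIV. norm (e i) * norm (\<kappa> n i))" for n
  \<comment> \<open>\<open>G x n\<close> estimates the degree \<open>n\<close> part of
    \<open>x\<close>, since \<open>T ^^ n\<close> contributes a factor \<open>r ^ n\<close> in the
    cutoff seminorm. \<open>K\<close> is its summable majorant for unit vectors.\<close>
  define G where "G x n = r ^ n * (\<Sum>i\<in>UNIV. norm (e i) * cmod (cinner x (\<kappa> n i)))" for x n
  have summable_K: "summable K"
    unfolding K_def using summable_coefficient_norms[OF r, of "\<lambda>i. norm (e i)"] .
  have K: "0 \<le> K n" for n using r unfolding K_def by (intro mult_nonneg_nonneg sum_nonneg) auto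
  have G: "0 \<le> G x n" for x n using r unfolding G_def by (intro mult_nonneg_nonneg sum_nonneg) auto
  have G_le: "G x n \<le> norm x * K n" for x n
  proof -
    have "(\<Sum>i\<in>UNIV. norm (e i) * cmod (cinner x (\<kappa> n i))) \<le> (\<Sum>i\<in>UNIV. norm (e i) * (norm x * norm (\<kappa> n i)))"
      by (intro sum_mono mult_left_mono norm_cinner_le norm_ge_zero)
    also have "\<dots> = norm x * (\<Sum>i\<in>UNIV. norm (e i) * norm (\<kappa> n i))"
      by (simp add: sum_distrib_left mult_ac)
    finally show ?thesis
      using r mult_left_mono[of _ _ "r ^ n"] by (simp add: G_def K_def mult.left_commute)
  qed
  have summable_G: "summable (G x)" for x
    by (rule summable_comparison_test'[OF summable_mult[OF summable_K, of "norm x"], of 0])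
       (use G G_le in auto)
  \<comment> \<open>A polynomial within \<open>\<delta>\<close> of \<open>x\<close> is estimated
    term by term. Its coefficients differ from those of \<open>x\<close> by at most
    \<open>\<delta> * norm (\<kappa> n i)\<close>, which accounts for
    \<open>\<delta> * suminf K\<close>; the first \<open>\<delta>\<close> covers the distance to
    \<open>x\<close>.\<close>
  have approx: "cutoff_le s x (\<delta> + (suminf (G x) + \<delta> * suminf K))" if \<delta>: "\<delta> > 0" for x \<delta>
  proof -
    obtain L c where Lc: "norm (x - polynomial L c) < \<delta>" using polynomials_dense[OF \<delta>] by blast
    have "cutoff_le s (polynomial L c) (\<Sum>n<L. \<Sum>i\<in>UNIV. r ^ n * norm (c n i *\<^sub>C e i))"
      unfolding module_poly_def
    proof (intro cutoff_le_sum)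
      fix n i
      interpret n: contraction_pair "T ^^ n" "T' ^^ n" by (rule funpow_contraction_pair)
      show "cutoff_le s (c n i *\<^sub>C (T ^^ n) (e i)) (r ^ n * norm (c n i *\<^sub>C e i))"
        using cutoff_le_funpow[of s n "c n i *\<^sub>C e i"] s unfolding r_def n.scaleC by simp
    qed auto
    moreover have "(\<Sum>n<L. \<Sum>i\<in>UNIV. r ^ n * norm (c n i *\<^sub>C e i)) \<le> (\<Sum>n<L. G x n + \<delta> * K n)"
    proof (rule sum_mono)
      fix n assume "n \<in> {..<L}"
      then have n: "n < L" by simp
      have "cmod (c n i) \<le> cmod (cinner x (\<kappa> n i)) + \<delta> * norm (\<kappa> n i)" for i
      proof -
        have "c n i = cinner x (\<kappa> n i) - cinner (x - polynomial L c) (\<kappa> n i)"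
          using n by (simp add: cinner_diff_left cinner_polynomial)
        also have "cmod \<dots> \<le> cmod (cinner x (\<kappa> n i)) + cmod (cinner (x - polynomial L c) (\<kappa> n i))"
          by (rule norm_triangle_ineq4)
        also have "cmod (cinner (x - polynomial L c) (\<kappa> n i)) \<le> \<delta> * norm (\<kappa> n i)"
          by (rule order_trans[OF norm_cinner_le]) (intro mult_right_mono less_imp_le[OF Lc] norm_ge_zero)
        finally show ?thesis by simp
      qed
      then have "(\<Sum>i\<in>UNIV. norm (e i) * cmod (c n i))
          \<le> (\<Sum>i\<in>UNIV. norm (e i) * (cmod (cinner x (\<kappa> n i)) + \<delta> * norm (\<kappa> n i)))"
        by (intro sum_mono mult_left_mono) auto
      then have "r ^ n * (\<Sum>i\<in>UNIV. norm (e i) * cmod (c n i))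
          \<le> r ^ n * (\<Sum>i\<in>UNIV. norm (e i) * (cmod (cinner x (\<kappa> n i)) + \<delta> * norm (\<kappa> n i)))"
        using r by (intro mult_left_mono) auto
      also have "\<dots> = G x n + \<delta> * K n"
        by (simp add: G_def K_def distrib_left sum.distrib sum_distrib_left mult_ac)
      finally show "(\<Sum>i\<in>UNIV. r ^ n * norm (c n i *\<^sub>C e i)) \<le> G x n + \<delta> * K n"
        by (simp add: sum_distrib_left mult_ac)
    qed
    moreover have "(\<Sum>n<L. G x n + \<delta> * K n) \<le> suminf (G x) + \<delta> * suminf K"
    proof -
      have "(\<Sum>n<L. G x n + \<delta> * K n) \<le> (\<Sum>n. G x n + \<delta> * K n)"
        using \<delta> G K by (intro sum_le_suminf summable_add summable_mult summable_G summable_K) auto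
      also have "\<dots> = suminf (G x) + \<delta> * suminf K"
        by (simp add: suminf_add[symmetric] suminf_mult summable_G summable_K summable_mult)
      finally show ?thesis .
    qed
    ultimately have "cutoff_le s (polynomial L c) (suminf (G x) + \<delta> * suminf K)"
      by (meson cutoff_le_mono order_trans)
    moreover have "cutoff_le s (x - polynomial L c) \<delta>"
      using cutoff_le_mono[OF cutoff_le_norm less_imp_le[OF Lc]] .
    ultimately show ?thesis using cutoff_le_add[of s "x - polynomial L c" \<delta> "polynomial L c"] by simp
  qed
  have bound: "cutoff_le s x (suminf (G x))" for x
  proof (rule cutoff_le_limit)
    show "cutoff_le s x (1 / real (Suc k) + (suminf (G x) + 1 / real (Suc k) * suminf K))" for k
      by (rule approx) simp
    have "(\<lambda>k. 1 / real (Suc k) + (suminf (G x) + 1 / real (Suc k) * suminf K))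
        \<longlonglongrightarrow> 0 + (suminf (G x) + 0 * suminf K)"
      by (intro tendsto_intros LIMSEQ_Suc[OF lim_1_over_n])
    then show "(\<lambda>k. 1 / real (Suc k) + (suminf (G x) + 1 / real (Suc k) * suminf K)) \<longlonglongrightarrow> suminf (G x)"
      by simp
  qed
  show "cutoff_le s f 0"
  proof (rule cutoff_le_limit)
    show "cutoff_le s f (suminf (G ((U ^^ k) f)))" for k
      by (rule cutoff_le_U[OF bound])
    \<comment> \<open>Dominated convergence for series: weak nullness of the orbit gives the
      termwise limit, and the isometry of \<open>U\<close> gives the majorant
      \<open>norm f * K n\<close>.\<close>
    have "(\<lambda>k. suminf (\<lambda>n. G ((U ^^ k) f) n)) \<longlonglongrightarrow> suminf (\<lambda>n. 0)"
    proof (rule conjunct2[OF conjunct2[OF tannerys_theorem[of "\<lambda>n k. G ((U ^^ k) f) n" "\<lambda>n. 0" sequentially "\<lambda>n. norm f * K n"]]])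
      show "(\<lambda>k. G ((U ^^ k) f) n) \<longlonglongrightarrow> 0" for n
      proof -
        have "(\<lambda>k. cinner ((U ^^ k) f) (\<kappa> n i)) \<longlonglongrightarrow> 0" for i
          using U.funpow_weakly_null unfolding weakly_null_def by blast
        then have "(\<lambda>k. G ((U ^^ k) f) n) \<longlonglongrightarrow> r ^ n * (\<Sum>i\<in>UNIV. norm (e i) * cmod 0)"
          unfolding G_def by (intro tendsto_intros)
        then show ?thesis by simp
      qed
      show "\<forall>\<^sub>F (n, k) in sequentially \<times>\<^sub>F sequentially. norm (G ((U ^^ k) f) n) \<le> norm f * K n"
        using G_le[of "(U ^^ _) f"] G by (intro always_eventually) (auto simp: U.funpow_isometry)
      show "summable (\<lambda>n. norm f * K n)" by (intro summable_mult summable_K)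
    qed simp
    then show "(\<lambda>k. suminf (G ((U ^^ k) f))) \<longlonglongrightarrow> 0" by simp
  qed
qed

sublocale pure_isometry T T'
  by (intro pure_isometry.intro pure_isometry_axioms.intro contraction_pair_axioms isometry pure)

text \<open>Subtracting from \<open>f\<close> its value at the origin leaves an element of the closed subspace \<open>T \<M>\<close>,
  so evaluation at the origin maps the wandering subspace \<open>ker T\<^sup>*\<close> isomorphically onto the
  coefficient space.\<close>

lemma subtract_value_at_0: "f - (\<Sum>i\<in>UNIV. cinner f (\<kappa> 0 i) *\<^sub>C e i) \<in> range T"
proof -
  define E where "E f = f - (\<Sum>i\<in>UNIV. cinner f (\<kappa> 0 i) *\<^sub>C e i)" for f
  obtain L c where lim: "(\<lambda>l. polynomial (L l) (c l)) \<longlonglongrightarrow> f" by (rule module_poly_tendsto[OF polynomials_dense])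
  \<comment> \<open>Membership in the range of the isometry \<open>T\<close> is expressed as being
    fixed by \<open>T T'\<close>, a condition that survives the limit from polynomials.\<close>
  have "T (T' (E (polynomial L c))) = E (polynomial L c)" for L c
  proof (cases L)
    case 0
    then show ?thesis by (simp add: E_def module_poly_def adjoint.sum)
  next
    case (Suc M)
    have "polynomial (Suc M) c = (\<Sum>i\<in>UNIV. c 0 i *\<^sub>C e i) + T (\<Sum>n<M. \<Sum>i\<in>UNIV. c (Suc n) i *\<^sub>C (T ^^ n) (e i))"
      unfolding module_poly_def by (subst sum.lessThan_Suc_shift) (simp add: sum)
    then have "E (polynomial L c) = T (\<Sum>n<M. \<Sum>i\<in>UNIV. c (Suc n) i *\<^sub>C (T ^^ n) (e i))"
      unfolding E_def cinner_polynomial using Suc by simp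
    then show ?thesis by simp
  qed
  moreover have "(\<lambda>l. E (polynomial (L l) (c l))) \<longlonglongrightarrow> E f"
    unfolding E_def
    by (intro tendsto_intros lim bounded_linear.tendsto[OF bounded_linear_scaleC_left] tendsto_cinner_left)
  moreover from calculation(2) have "(\<lambda>l. T (T' (E (polynomial (L l) (c l))))) \<longlonglongrightarrow> T (T' (E f))"
    by (intro tendsto adjoint.tendsto)
  ultimately have "T (T' (E f)) = E f" by (simp add: LIMSEQ_unique)
  then have "E f \<in> range T" by (rule range_eqI[OF sym])
  then show ?thesis by (simp add: E_def)
qed

text \<open>The projections \<open>w i\<close> of the generators to the kernel form a basis: their
  constant coefficients are those of \<open>e i\<close>, as the range of \<open>T\<close>
  contributes none, and a kernel vector is the projection of its constant part.\<close>

lemma cdim_kernel_adjoint: "cdim {x. T' x = 0} = CARD('m)"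
proof -
  define w where "w i = e i - T (T' (e i))" for i
  have ker: "T' (w i) = 0" for i by (simp add: w_def adjoint.diff)
  have coeff: "cinner (\<Sum>i\<in>UNIV. c i *\<^sub>C w i) (\<kappa> 0 j) = c j" for c j
  proof -
    have "cinner (w i) (\<kappa> 0 j) = (if i = j then 1 else 0)" for i
      using cinner_generator[of 0 i 0 j] coefficient_funpow_eq_0[of 0 1 "T' (e i)" j]
      by (simp add: w_def cinner_diff_left)
    then have "cinner (\<Sum>i\<in>UNIV. c i *\<^sub>C w i) (\<kappa> 0 j) = (\<Sum>i\<in>UNIV. if i = j then c i else 0)"
      by (simp add: cinner_sum_left cinner_scaleC_left mult_delta_right)
    then show ?thesis by simp
  qed
  have inj: "inj w"
  proof (rule injI)
    fix i j assume "w i = w j"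
    moreover have "cinner (w k) (\<kappa> 0 i) = (if i = k then 1 else 0)" for k
      using coeff[of "\<lambda>l. if l = k then 1 else 0" i] by (simp add: if_distrib[of "\<lambda>c. c *\<^sub>C _"] cong: if_cong)
    ultimately show "i = j" by (metis zero_neq_one)
  qed
  have "\<not> cdependent (range w)"
  proof
    assume "cdependent (range w)"
    then obtain u i where "u (w i) \<noteq> 0" and "(\<Sum>v\<in>range w. u v *\<^sub>C v) = 0"
      by (auto simp: complex_vector.dependent_finite)
    then have "(\<Sum>i\<in>UNIV. u (w i) *\<^sub>C w i) = 0" by (simp add: sum.reindex[OF inj])
    then show False using coeff[of "\<lambda>i. u (w i)" i] \<open>u (w i) \<noteq> 0\<close> by simp
  qed
  moreover have "x \<in> cspan (range w)" if x: "T' x = 0" for x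
  proof -
    obtain g where g: "x - (\<Sum>i\<in>UNIV. cinner x (\<kappa> 0 i) *\<^sub>C e i) = T g"
      using subtract_value_at_0[of x] by auto
    define y where "y = (\<Sum>i\<in>UNIV. cinner x (\<kappa> 0 i) *\<^sub>C e i)"
    have "x = T g + y" using g unfolding y_def by (simp add: diff_eq_eq)
    moreover have "g = - T' y"
      using x calculation by (simp add: eq_neg_iff_add_eq_0)
    ultimately have "x = y - T (T' y)"
      by (simp add: linear_simps(4)[OF bounded_linear])
    then have "x = (\<Sum>i\<in>UNIV. cinner x (\<kappa> 0 i) *\<^sub>C w i)"
      by (simp add: y_def w_def sum adjoint.sum complex_vector.scale_right_diff_distrib sum_subtractf)
    moreover have "\<dots> \<in> cspan (range w)"
      by (intro complex_vector.span_sum complex_vector.span_scale complex_vector.span_base rangeI)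
    ultimately show ?thesis by simp
  qed
  ultimately show ?thesis
    using ker inj by (intro complex_vector.dim_unique[of "range w"]) (auto simp: card_image)
qed

end

section \<open>The Wold representation\<close>

instance complex_hilbert_space \<subseteq> banach ..

context pure_isometry
begin

text \<open>Orthogonal projection onto the kernel of \<open>S\<close>, the wandering subspace of
  \<open>T\<close>.\<close>

definition wandering :: "'a \<Rightarrow> 'a" where "wandering x = x - T (S x)"

lemma cinner_wandering: "cinner (wandering x) (wandering y) = cinner x y - cinner (S x) (S y)"
  by (simp add: wandering_def cinner_diff_left cinner_diff_right adj adj')

lemma norm_wandering_le: "norm (wandering x) \<le> norm x"
proof -
  have "complex_of_real ((norm (wandering x))\<^sup>2) = of_real ((norm x)\<^sup>2 - (norm (S x))\<^sup>2)"
    using cinner_wandering[of x x] by (simp add: cinner_self)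
  then have "(norm (wandering x))\<^sup>2 = (norm x)\<^sup>2 - (norm (S x))\<^sup>2"
    by (simp only: of_real_eq_iff)
  then have "(norm (wandering x))\<^sup>2 \<le> (norm x)\<^sup>2"
    using zero_le_power2[of "norm (S x)"] by linarith
  then show ?thesis by (rule power2_le_imp_le) simp
qed

lemma wandering_add: "wandering (x + y) = wandering x + wandering y"
  and wandering_scaleC: "wandering (c *\<^sub>C x) = c *\<^sub>C wandering x"
  by (simp_all add: wandering_def complex_vector.scale_right_diff_distrib)

lemma adj_wandering: "S (wandering x) = 0"
  by (simp add: wandering_def adjoint.diff)

text \<open>Coefficient at \<open>T ^^ n\<close> in the Wold expansion: \<open>S ^^ n\<close> kills
  the lower terms and strips the power, and the projection discards the higher ones.\<close>

definition wold_coeff :: "'a \<Rightarrow> nat \<Rightarrow> 'a" where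
  "wold_coeff f n = wandering ((S ^^ n) f)"

lemma wold_coeff_add: "wold_coeff (f + g) n = wold_coeff f n + wold_coeff g n"
  and wold_coeff_scaleC: "wold_coeff (c *\<^sub>C f) n = c *\<^sub>C wold_coeff f n"
  using contraction_pair.add[OF adjoint.funpow_contraction_pair]
    contraction_pair.scaleC[OF adjoint.funpow_contraction_pair]
  by (simp_all add: wold_coeff_def wandering_add wandering_scaleC)

lemma norm_wold_coeff_le: "norm (wold_coeff f n) \<le> norm f"
  unfolding wold_coeff_def
  using norm_wandering_le contraction_pair.norm_le[OF adjoint.funpow_contraction_pair]
  by (rule order_trans)

lemma wold_coeff_bounded_linear: "bounded_linear (\<lambda>f. wold_coeff f n)"
  by (rule bounded_linear_intro[where K=1])
     (simp_all add: wold_coeff_add wold_coeff_scaleC scaleR_scaleC norm_wold_coeff_le)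

lemma wold_coeff_shift: "wold_coeff (T f) 0 = 0" "wold_coeff (T f) (Suc n) = wold_coeff f n"
  by (simp_all add: wold_coeff_def wandering_def funpow_swap1)

text \<open>Parseval by telescoping: each summand is the drop of
  \<open>cinner ((S ^^ n) f) ((S ^^ n) g)\<close> from \<open>n\<close> to \<open>n + 1\<close>, and
  purity sends the remainder to 0.\<close>

lemma cinner_sums_wold_coeff: "(\<lambda>n. cinner (wold_coeff f n) (wold_coeff g n)) sums cinner f g"
proof -
  have "(\<lambda>n. cinner ((S ^^ n) f) ((S ^^ n) g)) \<longlonglongrightarrow> 0"
  proof (rule Lim_null_comparison)
    show "\<forall>\<^sub>F n in sequentially. norm (cinner ((S ^^ n) f) ((S ^^ n) g)) \<le> norm ((S ^^ n) f) * norm g"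
      by (intro always_eventually allI order_trans[OF norm_cinner_le] mult_left_mono norm_ge_zero
          contraction_pair.norm_le[OF adjoint.funpow_contraction_pair])
    show "(\<lambda>n. norm ((S ^^ n) f) * norm g) \<longlonglongrightarrow> 0"
      by (intro tendsto_mult_left_zero tendsto_norm_zero adj_funpow_tendsto_0)
  qed
  from telescope_sums'[OF this] show ?thesis
    by (simp add: wold_coeff_def cinner_wandering)
qed

lemma summable_norm_wold_coeff: "summable (\<lambda>n. (norm (wold_coeff f n))\<^sup>2)"
  using bounded_linear.summable[OF bounded_linear_Re sums_summable[OF cinner_sums_wold_coeff[of f f]]]
  by (simp add: cinner_self)

definition wold_map :: "'a \<Rightarrow> complex \<Rightarrow> 'a" where
  "wold_map f z = (if z \<in> \<D> then \<Sum>n. z ^ n *\<^sub>C wold_coeff f n else 0)"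

text \<open>The second bound makes point evaluation continuous in \<open>f\<close>, which later
  carries the module identity from polynomials to the disk algebra.\<close>

lemma wold_map_sums:
  assumes "z \<in> \<D>"
  shows "(\<lambda>n. z ^ n *\<^sub>C wold_coeff f n) sums wold_map f z"
    and "norm (wold_map f z) \<le> norm f / (1 - cmod z)"
proof -
  have z: "cmod z < 1" using assms by simp
  have geo: "(\<lambda>n. cmod z ^ n * norm f) sums (1 / (1 - cmod z) * norm f)"
    using z by (intro sums_mult2 geometric_sums) simp
  have le: "norm (z ^ n *\<^sub>C wold_coeff f n) \<le> cmod z ^ n * norm f" for n
    by (simp add: norm_power mult_left_mono norm_wold_coeff_le)
  have summable: "summable (\<lambda>n. z ^ n *\<^sub>C wold_coeff f n)"
    by (rule summable_comparison_test'[OF sums_summable[OF geo], of 0]) (rule le)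
  then show "(\<lambda>n. z ^ n *\<^sub>C wold_coeff f n) sums wold_map f z"
    using assms by (simp add: wold_map_def summable_sums)
  show "norm (wold_map f z) \<le> norm f / (1 - cmod z)"
    using norm_suminf_le[OF le sums_summable[OF geo]] sums_unique[OF geo] assms
    by (simp add: wold_map_def)
qed

lemma hardy_series_wold_map: "hardy_series (wold_coeff f) (wold_map f)"
  unfolding hardy_series_def
  using summable_norm_wold_coeff wold_map_sums(1) by (simp add: wold_map_def)

lemma wold_map_eqI: "(\<And>z. z \<in> \<D> \<Longrightarrow> wold_map f z = h z) \<Longrightarrow> (\<And>z. z \<notin> \<D> \<Longrightarrow> h z = 0) \<Longrightarrow> wold_map f = h"
  by (rule ext) (metis wold_map_def)

lemma wold_map_add: "wold_map (f + g) = (\<lambda>z. wold_map f z + wold_map g z)"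
proof (rule wold_map_eqI)
  fix z assume z: "z \<in> \<D>"
  have "(\<lambda>n. z ^ n *\<^sub>C wold_coeff (f + g) n) sums (wold_map f z + wold_map g z)"
    using sums_add[OF wold_map_sums(1)[OF z] wold_map_sums(1)[OF z]]
    by (simp add: wold_coeff_add scaleC_add_right)
  then show "wold_map (f + g) z = wold_map f z + wold_map g z"
    using wold_map_sums(1)[OF z] sums_unique2 by blast
qed (simp add: wold_map_def)

lemma wold_map_scaleC: "wold_map (c *\<^sub>C f) = (\<lambda>z. c *\<^sub>C wold_map f z)"
proof (rule wold_map_eqI)
  fix z assume z: "z \<in> \<D>"
  have "(\<lambda>n. z ^ n *\<^sub>C wold_coeff (c *\<^sub>C f) n) sums (c *\<^sub>C wold_map f z)"
    using bounded_linear.sums[OF bounded_linear_scaleC_right wold_map_sums(1)[OF z], of c f]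
    by (simp add: wold_coeff_scaleC scaleC_scaleC mult.commute)
  then show "wold_map (c *\<^sub>C f) z = c *\<^sub>C wold_map f z"
    using wold_map_sums(1)[OF z] sums_unique2 by blast
qed (simp add: wold_map_def)

lemma wold_map_shift: "wold_map (T f) = (\<lambda>z. z *\<^sub>C wold_map f z)"
proof (rule wold_map_eqI)
  fix z assume z: "z \<in> \<D>"
  have "(\<lambda>n. z ^ Suc n *\<^sub>C wold_coeff (T f) (Suc n)) sums (z *\<^sub>C wold_map f z)"
    using bounded_linear.sums[OF bounded_linear_scaleC_right wold_map_sums(1)[OF z], of z f]
    by (simp add: wold_coeff_shift scaleC_scaleC)
  then have "(\<lambda>n. z ^ n *\<^sub>C wold_coeff (T f) n) sums (z *\<^sub>C wold_map f z)"
    by (subst (asm) sums_Suc_iff) (simp add: wold_coeff_shift)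
  then show "wold_map (T f) z = z *\<^sub>C wold_map f z"
    using wold_map_sums(1)[OF z] sums_unique2 by blast
qed (simp add: wold_map_def)

lemma hardy_inner_wold_map: "hardy_inner (wold_map f) (wold_map g) = cinner f g"
  unfolding hardy_inner_def hardy_coeffs_eq[OF hardy_series_wold_map]
  using cinner_sums_wold_coeff by (rule sums_unique[symmetric])

text \<open>Cancelling \<open>T ^^ m\<close> leaves \<open>a\<close> against a vector in the range
  of \<open>T\<close>, to which the kernel of \<open>S\<close> is orthogonal.\<close>

lemma cinner_funpow_wandering:
  assumes "S a = 0" "m < n"
  shows "cinner ((T ^^ m) a) ((T ^^ n) b) = 0"
proof -
  obtain k where n: "n = m + Suc k" using assms(2) by (auto dest: less_imp_Suc_add)
  have "cinner ((T ^^ m) a) ((T ^^ n) b) = cinner a (T ((T ^^ k) b))"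
    unfolding n funpow_add o_apply cinner_funpow by simp
  then show ?thesis using assms(1) by (simp add: adj'[symmetric])
qed

lemma wold_coeff_funpow:
  assumes "S a = 0"
  shows "wold_coeff ((T ^^ j) a) n = (if j = n then a else 0)"
proof (induction j arbitrary: n)
  case 0
  show ?case
  proof (cases n)
    case 0
    then show ?thesis using assms by (simp add: wold_coeff_def wandering_def)
  next
    case (Suc k)
    then show ?thesis
      using assms contraction_pair.zero[OF adjoint.funpow_contraction_pair, of k]
      by (simp add: wold_coeff_def wandering_def funpow_swap1)
  qed
next
  case (Suc j)
  then show ?case by (cases n) (simp_all add: wold_coeff_shift)
qed

text \<open>The vectors \<open>(T ^^ n) (a n)\<close> are pairwise orthogonal with norms
  \<open>norm (a n)\<close>, so by Pythagoras square summability makes their series converge; its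
  coefficients are read off termwise by continuity.\<close>

lemma wold_series_exists:
  assumes a: "\<And>n. S (a n) = 0" and summable: "summable (\<lambda>n. (norm (a n))\<^sup>2)"
  obtains f where "wold_coeff f = a"
proof -
  define g where "g n = (T ^^ n) (a n)" for n
  have orth: "pairwise (\<lambda>i j. orthogonal (g i) (g j)) I" for I
  proof (rule pairwiseI)
    fix i j :: nat assume "i \<noteq> j"
    have "cinner (g i) (g j) = 0 \<or> cinner (g j) (g i) = 0"
      using cinner_funpow_wandering[OF a] \<open>i \<noteq> j\<close> unfolding g_def by (metis nat_neq_iff)
    then show "orthogonal (g i) (g j)"
      unfolding orthogonal_def by (metis inner_Re_cinner inner_commute zero_complex.sel(1))
  qed
  have norm_g: "(norm (sum g {m..<n}))\<^sup>2 = (\<Sum>i=m..<n. (norm (a i))\<^sup>2)" for m n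
    using norm_sum_Pythagorean[OF _ orth, of "{m..<n}"] by (simp add: g_def funpow_isometry)
  have "summable g"
    unfolding summable_Cauchy
  proof (intro allI impI)
    fix \<epsilon> :: real assume \<epsilon>: "\<epsilon> > 0"
    then obtain N where N: "\<And>m n. m \<ge> N \<Longrightarrow> norm (\<Sum>i=m..<n. (norm (a i))\<^sup>2) < \<epsilon>\<^sup>2"
      using summable[unfolded summable_Cauchy] by (meson zero_less_power)
    have "norm (sum g {m..<n}) < \<epsilon>" if "m \<ge> N" for m n
    proof -
      have "(norm (sum g {m..<n}))\<^sup>2 < \<epsilon>\<^sup>2"
        unfolding norm_g using N[OF that, of n] by simp
      then show ?thesis using \<epsilon> by (simp add: power2_less_imp_less)
    qed
    then show "\<exists>N. \<forall>m\<ge>N. \<forall>n. norm (sum g {m..<n}) < \<epsilon>" by blast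
  qed
  have "wold_coeff (suminf g) n = a n" for n
  proof -
    have "(\<lambda>j. wold_coeff (g j) n) sums wold_coeff (suminf g) n"
      by (rule bounded_linear.sums[OF wold_coeff_bounded_linear summable_sums[OF \<open>summable g\<close>]])
    moreover have "(\<lambda>j. wold_coeff (g j) n) sums a n"
      using sums_single[of n a] by (simp add: g_def wold_coeff_funpow[OF a])
    ultimately show ?thesis by (rule sums_unique2)
  qed
  then show ?thesis using that by blast
qed

lemma range_wold_map: "range wold_map = hardy_space {x. S x = 0}"
proof
  have "range (wold_coeff f) \<subseteq> {x. S x = 0}" for f
    by (auto simp: wold_coeff_def adj_wandering)
  then show "range wold_map \<subseteq> hardy_space {x. S x = 0}"
    using hardy_series_wold_map unfolding hardy_space_def by blast
  show "hardy_space {x. S x = 0} \<subseteq> range wold_map"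
  proof
    fix h assume "h \<in> hardy_space {x. S x = 0}"
    then obtain a where a: "range a \<subseteq> {x. S x = 0}" and h: "hardy_series a h"
      unfolding hardy_space_def by blast
    obtain f where f: "wold_coeff f = a"
      using wold_series_exists[of a] a h unfolding hardy_series_def by blast
    have "wold_map f = h"
    proof (rule wold_map_eqI)
      fix z assume z: "z \<in> \<D>"
      then have "(\<lambda>n. z ^ n *\<^sub>C wold_coeff f n) sums h z"
        using h f unfolding hardy_series_def by blast
      then show "wold_map f z = h z" using wold_map_sums(1)[OF z] sums_unique2 by blast
    qed (use h in \<open>simp add: hardy_series_def\<close>)
    then show "h \<in> range wold_map" by blast
  qed
qed

lemma csubspace_kernel_adjoint: "csubspace {x. S x = 0}"
  by (simp add: csubspace_iff)

lemma closed_kernel_adjoint: "closed {x. S x = 0}"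
  by (intro closed_Collect_eq bounded_linear.continuous_on[OF adjoint.bounded_linear] continuous_intros)

end

section \<open>The disk algebra and its Hilbert modules\<close>

lemma disk_algebraE:
  assumes "\<phi> \<in> disk_algebra" "\<epsilon> > 0"
  obtains S g where "open S" "cball 0 1 \<subseteq> S" "g holomorphic_on S"
    "\<And>z. z \<in> \<D> \<Longrightarrow> cmod (\<phi> z - g z) < \<epsilon>"
proof -
  have "\<exists>S g. open S \<and> cball 0 1 \<subseteq> S \<and> g holomorphic_on S \<and> (\<forall>z\<in>\<D>. cmod (\<phi> z - g z) < \<epsilon>)"
    using assms by (simp add: disk_algebra_def)
  then show ?thesis using that by metis
qed

lemma disk_algebra_cmult: "\<phi> \<in> disk_algebra \<Longrightarrow> (\<lambda>z. c * \<phi> z) \<in> disk_algebra"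
  unfolding disk_algebra_def
proof (intro CollectI conjI allI impI; elim CollectE conjE)
  fix \<epsilon> :: real
  assume \<epsilon>: "\<epsilon> > 0" and \<phi>: "\<forall>\<epsilon>>0. \<exists>S g. open S \<and> cball 0 1 \<subseteq> S \<and> g holomorphic_on S \<and> (\<forall>z\<in>\<D>. cmod (\<phi> z - g z) < \<epsilon>)"
  have pos: "cmod c + 1 > 0" by (simp add: add_nonneg_pos)
  then have "\<epsilon> / (cmod c + 1) > 0" using \<epsilon> by simp
  then obtain S g where g: "open S" "cball 0 1 \<subseteq> S" "g holomorphic_on S"
    "\<And>z. z \<in> \<D> \<Longrightarrow> cmod (\<phi> z - g z) < \<epsilon> / (cmod c + 1)"
    using \<phi> by meson
  have "cmod (c * \<phi> z - c * g z) < \<epsilon>" if "z \<in> \<D>" for z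
  proof -
    have "cmod (c * \<phi> z - c * g z) = cmod c * cmod (\<phi> z - g z)"
      by (simp add: right_diff_distrib[symmetric] norm_mult)
    also have "\<dots> \<le> (cmod c + 1) * cmod (\<phi> z - g z)" by (intro mult_right_mono) auto
    also have "\<dots> < \<epsilon>" using g(4)[OF that] pos by (simp add: pos_less_divide_eq mult.commute)
    finally show ?thesis .
  qed
  then show "\<exists>S h. open S \<and> cball 0 1 \<subseteq> S \<and> h holomorphic_on S \<and> (\<forall>z\<in>\<D>. cmod (c * \<phi> z - h z) < \<epsilon>)"
    using g by (intro exI[of _ S] exI[of _ "\<lambda>z. c * g z"]) (auto intro!: holomorphic_intros)
qed auto

lemma disk_algebra_add:
  assumes "\<phi> \<in> disk_algebra" "\<psi> \<in> disk_algebra"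
  shows "(\<lambda>z. \<phi> z + \<psi> z) \<in> disk_algebra"
  unfolding disk_algebra_def
proof (intro CollectI conjI allI impI)
  show "\<phi> z + \<psi> z = 0" if "z \<notin> \<D>" for z using assms that by (auto simp: disk_algebra_def)
  fix \<epsilon> :: real assume "\<epsilon> > 0"
  then have \<epsilon>: "\<epsilon> / 2 > 0" by simp
  obtain S g where g: "open S" "cball 0 1 \<subseteq> S" "g holomorphic_on S"
    "\<And>z. z \<in> \<D> \<Longrightarrow> cmod (\<phi> z - g z) < \<epsilon> / 2"
    using disk_algebraE[OF assms(1) \<epsilon>] by metis
  obtain S' g' where g': "open S'" "cball 0 1 \<subseteq> S'" "g' holomorphic_on S'"
    "\<And>z. z \<in> \<D> \<Longrightarrow> cmod (\<psi> z - g' z) < \<epsilon> / 2"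
    using disk_algebraE[OF assms(2) \<epsilon>] by metis
  have "cmod (\<phi> z + \<psi> z - (g z + g' z)) < \<epsilon>" if "z \<in> \<D>" for z
    using norm_triangle_ineq[of "\<phi> z - g z" "\<psi> z - g' z"] g(4)[OF that] g'(4)[OF that]
    by (simp add: algebra_simps)
  moreover have "(\<lambda>z. g z + g' z) holomorphic_on S \<inter> S'"
    using g(3) g'(3) by (intro holomorphic_intros) (auto elim: holomorphic_on_subset)
  ultimately show "\<exists>S h. open S \<and> cball 0 1 \<subseteq> S \<and> h holomorphic_on S \<and> (\<forall>z\<in>\<D>. cmod (\<phi> z + \<psi> z - h z) < \<epsilon>)"
    using g g' by (intro exI[of _ "S \<inter> S'"] exI[of _ "\<lambda>z. g z + g' z"]) auto
qed

text \<open>Truncation to 0 off the disk matches the convention of \<open>disk_algebra\<close>;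
  \<open>disk_poly 1\<close> is the unit and \<open>disk_poly [:0, 1:]\<close> the coordinate
  function.\<close>

definition disk_poly :: "complex poly \<Rightarrow> complex \<Rightarrow> complex" where
  "disk_poly p z = (if z \<in> \<D> then poly p z else 0)"

lemma disk_poly_in_disk_algebra: "disk_poly p \<in> disk_algebra"
  unfolding disk_algebra_def disk_poly_def
  by (auto intro!: exI[of _ UNIV] exI[of _ "poly p"] holomorphic_intros)

lemma disk_poly_pCons:
  "disk_poly (pCons a p) = (\<lambda>z. a * disk_poly 1 z + disk_poly [:0, 1:] z * disk_poly p z)"
  by (auto simp: fun_eq_iff disk_poly_def)

text \<open>By compactness \<open>g\<close> is holomorphic on a disk of radius above 1, so its
  Taylor series converges absolutely and uniformly on the closed unit disk.\<close>

lemma holomorphic_uniform_poly_approx: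
  assumes "open S" "cball 0 1 \<subseteq> S" "g holomorphic_on S" and \<epsilon>: "\<epsilon> > 0"
  obtains p where "\<And>z. z \<in> cball 0 1 \<Longrightarrow> cmod (g z - poly p z) < \<epsilon>"
proof -
  obtain R where R: "R > 1" "ball 0 R \<subseteq> S"
  proof -
    obtain d where d: "d > 0" "(\<Union>x\<in>cball 0 1. ball x d) \<subseteq> S"
      using compact_subset_open_imp_ball_epsilon_subset[OF compact_cball assms(1,2)] by metis
    have "ball 0 (1 + d) \<subseteq> S"
    proof
      fix z :: complex assume z: "z \<in> ball 0 (1 + d)"
      show "z \<in> S"
      proof (cases "cmod z \<le> 1")
        case True
        then show ?thesis using assms(2) by auto
      next
        case False
        have "norm (sgn z) = 1" using False by (auto simp: norm_sgn)
        moreover have "norm (z - sgn z) < d"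
        proof -
          have "z - sgn z = of_real (1 - 1 / cmod z) * z"
            by (simp add: sgn_div_norm scaleR_conv_of_real algebra_simps divide_inverse)
          moreover have "0 \<le> 1 - 1 / cmod z" using False by (simp add: divide_le_eq)
          ultimately have "norm (z - sgn z) = (1 - 1 / cmod z) * cmod z"
            by (simp only: norm_mult norm_of_real abs_of_nonneg)
          also have "\<dots> = cmod z - 1" using False by (auto simp: left_diff_distrib) 
          finally show ?thesis using z by simp
        qed
        ultimately have "sgn z \<in> cball 0 1" "z \<in> ball (sgn z) d"
          by (auto simp: dist_norm norm_minus_commute)
        then show ?thesis using d(2) by blast
      qed
    qed
    then show ?thesis using that[of "1 + d"] d(1) by simp
  qed
  define a where "a n = (deriv ^^ n) g 0 / fact n" for n
  have sums: "(\<lambda>n. a n * w ^ n) sums g w" if "w \<in> ball 0 R" for w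
    using holomorphic_power_series[OF holomorphic_on_subset[OF assms(3) R(2)] that] by (simp add: a_def)
  define \<rho> where "\<rho> = (1 + R) / 2"
  have \<rho>: "1 < \<rho>" "\<rho> < R" using R(1) by (auto simp: \<rho>_def)
  have "summable (\<lambda>n. a n * of_real \<rho> ^ n)"
    using sums[of "of_real \<rho>"] \<rho> by (intro sums_summable) auto
  then have summable: "summable (\<lambda>n. norm (a n * 1 ^ n))"
    by (rule powser_insidea) (use \<rho> in simp)
  have "uniform_limit (cball 0 1) (\<lambda>n x. \<Sum>i<n. a i * x ^ i) (\<lambda>x. suminf (\<lambda>i. a i * x ^ i)) sequentially"
  proof (rule Weierstrass_m_test)
    show "norm (a n * x ^ n) \<le> norm (a n * 1 ^ n)" if "x \<in> cball 0 1" for n x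
      using that by (simp add: norm_mult norm_power mult_left_le power_le_one)
  qed (rule summable)
  from eventually_happens'[OF sequentially_bot uniform_limitD[OF this \<epsilon>]] obtain n
    where n: "\<And>x. x \<in> cball 0 1 \<Longrightarrow> dist (\<Sum>i<n. a i * x ^ i) (suminf (\<lambda>i. a i * x ^ i)) < \<epsilon>"
    by blast
  have "cmod (g z - poly (\<Sum>i<n. monom (a i) i) z) < \<epsilon>" if "z \<in> cball 0 1" for z
  proof -
    have "g z = suminf (\<lambda>i. a i * z ^ i)"
      using sums[of z] that R(1) by (intro sums_unique) auto
    then show ?thesis
      using n[OF that] by (simp add: dist_norm norm_minus_commute poly_sum poly_monom)
  qed
  then show ?thesis using that by blast
qed

lemma disk_algebra_poly_approx:
  assumes "\<phi> \<in> disk_algebra" "\<epsilon> > 0"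
  obtains p where "\<And>z. z \<in> \<D> \<Longrightarrow> cmod (\<phi> z - disk_poly p z) < \<epsilon>"
proof -
  have \<epsilon>: "\<epsilon> / 2 > 0" using assms(2) by simp
  obtain S g where g: "open S" "cball 0 1 \<subseteq> S" "g holomorphic_on S"
    "\<And>z. z \<in> \<D> \<Longrightarrow> cmod (\<phi> z - g z) < \<epsilon> / 2"
    using disk_algebraE[OF assms(1) \<epsilon>] by metis
  obtain p where p: "\<And>z. z \<in> cball 0 1 \<Longrightarrow> cmod (g z - poly p z) < \<epsilon> / 2"
    using holomorphic_uniform_poly_approx[OF g(1-3) \<epsilon>] by blast
  have "cmod (\<phi> z - disk_poly p z) < \<epsilon>" if "z \<in> \<D>" for z
    using norm_triangle_ineq[of "\<phi> z - g z" "g z - poly p z"] g(4)[OF that] p[of z] that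
    by (simp add: disk_poly_def)
  then show ?thesis using that by blast
qed

text \<open>Cauchy's inequality on the circle of radius \<open>\<rho>\<close>, with coefficients
  read off from derivatives at 0.\<close>

lemma poly_coeff_bound:
  assumes "\<rho> > 0" and bound: "\<And>z. cmod z = \<rho> \<Longrightarrow> cmod (poly p z) \<le> B"
  shows "cmod (coeff p n) \<le> B / \<rho> ^ n"
proof -
  have "(deriv ^^ n) (poly p) = poly ((pderiv ^^ n) p)"
  proof (induction n)
    case (Suc n)
    have "deriv (poly q) = poly (pderiv q)" for q :: "complex poly"
      by (rule ext) (rule DERIV_imp_deriv[OF poly_DERIV])
    then show ?case using Suc by simp
  qed simp
  then have "(deriv ^^ n) (poly p) 0 = fact n * coeff p n"
    by (simp add: poly_0_coeff_0 coeff_higher_pderiv pochhammer_fact)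
  moreover have "cmod ((deriv ^^ n) (poly p) 0) \<le> fact n * B / \<rho> ^ n"
    by (rule Cauchy_inequality) (use assms in \<open>auto intro!: holomorphic_intros continuous_intros\<close>)
  ultimately show ?thesis using assms(1) by (simp add: norm_mult field_simps)
qed

locale hilbert_disk_module =
  fixes act :: "(complex \<Rightarrow> complex) \<Rightarrow> 'a \<Rightarrow> 'a::{complex_hilbert_space, second_countable_topology}"
  assumes hilbert_module: "hilbert_module act"
begin

definition shift :: "'a \<Rightarrow> 'a" where "shift = act (disk_poly [:0, 1:])"

lemma act_clinear: "\<phi> \<in> disk_algebra \<Longrightarrow> clinear (act \<phi>)"
  and act_add: "\<phi> \<in> disk_algebra \<Longrightarrow> \<psi> \<in> disk_algebra \<Longrightarrow> act (\<lambda>z. \<phi> z + \<psi> z) f = act \<phi> f + act \<psi> f"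
  and act_cmult: "\<phi> \<in> disk_algebra \<Longrightarrow> act (\<lambda>z. c * \<phi> z) f = c *\<^sub>C act \<phi> f"
  and act_mult: "\<phi> \<in> disk_algebra \<Longrightarrow> \<psi> \<in> disk_algebra \<Longrightarrow> act (\<lambda>z. \<phi> z * \<psi> z) f = act \<phi> (act \<psi> f)"
  and act_norm_le: "\<phi> \<in> disk_algebra \<Longrightarrow> norm (act \<phi> f) \<le> disk_norm \<phi> * norm f"
  using hilbert_module unfolding hilbert_module_def by blast+

lemma act_one: "act (disk_poly 1) f = f"
proof -
  have "disk_poly 1 = (\<lambda>z. if z \<in> \<D> then 1 else 0)" by (auto simp: disk_poly_def)
  then show ?thesis using hilbert_module unfolding hilbert_module_def by simp
qed

lemma act_norm_le_bound:
  assumes "\<phi> \<in> disk_algebra" "\<And>z. z \<in> \<D> \<Longrightarrow> cmod (\<phi> z) \<le> B"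
  shows "norm (act \<phi> f) \<le> B * norm f"
proof -
  have "disk_norm \<phi> \<le> B"
    unfolding disk_norm_def by (rule cSUP_least) (use assms(2) in auto)
  then show ?thesis
    by (intro order_trans[OF act_norm_le[OF assms(1)]] mult_right_mono) auto
qed

lemma act_pCons: "act (disk_poly (pCons a p)) f = a *\<^sub>C f + shift (act (disk_poly p) f)"
  unfolding disk_poly_pCons[of a p] shift_def
proof (subst act_add)
  have "(\<lambda>z. disk_poly [:0, 1:] z * disk_poly p z) = disk_poly ([:0, 1:] * p)"
    by (auto simp: disk_poly_def)
  then show "(\<lambda>z. disk_poly [:0, 1:] z * disk_poly p z) \<in> disk_algebra"
    using disk_poly_in_disk_algebra by simp
qed (simp_all add: act_cmult act_mult act_one disk_poly_in_disk_algebra disk_algebra_cmult)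

text \<open>The sup norm bound on the action turns uniform approximation of \<open>\<phi>\<close>
  into approximation in operator norm.\<close>

lemma act_approx:
  assumes "\<phi> \<in> disk_algebra" "\<epsilon> > 0"
  obtains p where "\<And>z. z \<in> \<D> \<Longrightarrow> cmod (\<phi> z - disk_poly p z) < \<epsilon>"
    "\<And>f. norm (act \<phi> f - act (disk_poly p) f) \<le> \<epsilon> * norm f"
proof -
  obtain p where p: "\<And>z. z \<in> \<D> \<Longrightarrow> cmod (\<phi> z - disk_poly p z) < \<epsilon>"
    using disk_algebra_poly_approx[OF assms] by blast
  have "norm (act \<phi> f - act (disk_poly p) f) \<le> \<epsilon> * norm f" for f
  proof -
    have mem: "(\<lambda>z. (-1) * disk_poly p z) \<in> disk_algebra"
      by (intro disk_algebra_cmult disk_poly_in_disk_algebra)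
    have "act \<phi> f - act (disk_poly p) f = act (\<lambda>z. \<phi> z + (-1) * disk_poly p z) f"
      unfolding act_add[OF assms(1) mem] act_cmult[OF disk_poly_in_disk_algebra] by simp
    also have "norm \<dots> \<le> \<epsilon> * norm f"
      using p by (intro act_norm_le_bound disk_algebra_add assms mem) (auto intro: less_imp_le)
    finally show ?thesis .
  qed
  with p that show ?thesis by blast
qed

lemma shift_contraction: "clinear shift" "norm (shift f) \<le> norm f"
  using act_norm_le_bound[OF disk_poly_in_disk_algebra, of "[:0, 1:]" 1 f]
  by (auto simp: shift_def disk_poly_def act_clinear disk_poly_in_disk_algebra)

text \<open>\<open>L\<close> may exceed the degree plus one, so that polynomials of different
  degrees can share one range of summation.\<close>

lemma act_disk_poly_eq_sum:
  assumes "\<And>n. n \<ge> L \<Longrightarrow> coeff p n = 0"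
  shows "act (disk_poly p) f = (\<Sum>n<L. coeff p n *\<^sub>C (shift ^^ n) f)"
  using assms
proof (induction p arbitrary: L)
  case 0
  have "disk_poly 0 = (\<lambda>z. 0 * disk_poly 1 z)" by (auto simp: disk_poly_def)
  then have "act (disk_poly 0) f = 0 *\<^sub>C act (disk_poly 1) f"
    using act_cmult[OF disk_poly_in_disk_algebra] by metis
  then show ?case by simp
next
  case (pCons a p)
  have "coeff (pCons a p) n \<noteq> 0 \<Longrightarrow> L > 0" for n using pCons.prems[of n] by (cases "L = 0") auto
  moreover have "\<exists>n. coeff (pCons a p) n \<noteq> 0"
    using pCons.hyps by (metis leading_coeff_0_iff pCons_eq_0_iff)
  ultimately obtain M where L: "L = Suc M" by (cases L) auto
  have lin: "shift (x + y) = shift x + shift y" "shift (c *\<^sub>C x) = c *\<^sub>C shift x" "shift 0 = 0" for x y c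
    using shift_contraction(1) shift_contraction(2)[of 0] unfolding clinear_iff by auto
  have sum: "shift (\<Sum>n\<in>I. h n) = (\<Sum>n\<in>I. shift (h n))" for h and I :: "nat set"
    by (induction I rule: infinite_finite_induct) (simp_all add: lin)
  have "coeff p n = 0" if "n \<ge> M" for n using pCons.prems[of "Suc n"] that L by simp
  then have "shift (act (disk_poly p) f) = (\<Sum>n<M. coeff p n *\<^sub>C (shift ^^ Suc n) f)"
    using pCons.IH[of M] by (simp add: sum lin)
  then show ?case unfolding act_pCons L by (subst sum.lessThan_Suc_shift) simp
qed

end

section \<open>Quasi-free modules\<close>

locale quasi_free =
  fixes act :: "(complex \<Rightarrow> complex) \<Rightarrow> 'a \<Rightarrow> 'a::{complex_hilbert_space, second_countable_topology}"
    and J :: "(complex \<Rightarrow> complex ^ 'm) \<Rightarrow> 'a"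
  assumes quasi_free: "quasi_free_module act J"
begin

sublocale hilbert_disk_module act
  using quasi_free unfolding quasi_free_module_def by unfold_locales blast

lemma J_add: "F \<in> disk_tensor \<Longrightarrow> G \<in> disk_tensor \<Longrightarrow> J (\<lambda>z. F z + G z) = J F + J G"
  and J_scaleC: "F \<in> disk_tensor \<Longrightarrow> J (\<lambda>z. c *\<^sub>C F z) = c *\<^sub>C J F"
  and J_dense: "closure (J ` disk_tensor) = UNIV"
  and act_J: "\<phi> \<in> disk_algebra \<Longrightarrow> F \<in> disk_tensor \<Longrightarrow> act \<phi> (J F) = J (\<lambda>z. \<phi> z *\<^sub>C F z)"
  using quasi_free unfolding quasi_free_module_def by simp_all

lemma local_bound:
  assumes "z \<in> \<D>"
  obtains r C where "r > 0" "\<And>w F. w \<in> ball z r \<inter> \<D> \<Longrightarrow> F \<in> disk_tensor \<Longrightarrow> norm (F w) \<le> C * norm (J F)"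
proof -
  have "\<exists>r>0. \<exists>C. \<forall>w\<in>ball z r \<inter> \<D>. \<forall>F\<in>disk_tensor. norm (F w) \<le> C * norm (J F)"
    using quasi_free assms unfolding quasi_free_module_def by simp
  then show ?thesis using that by metis
qed

lemma J_null:
  assumes "\<And>i::nat. F i \<in> disk_tensor" "Cauchy (\<lambda>i. J (F i))" "\<And>z. z \<in> \<D> \<Longrightarrow> (\<lambda>i. F i z) \<longlonglongrightarrow> 0"
  shows "(\<lambda>i. norm (J (F i))) \<longlonglongrightarrow> 0"
proof -
  have "\<forall>F :: nat \<Rightarrow> complex \<Rightarrow> complex ^ 'm. (\<forall>i. F i \<in> disk_tensor) \<and> Cauchy (\<lambda>i. J (F i)) \<longrightarrow>
        ((\<forall>z\<in>\<D>. (\<lambda>i. F i z) \<longlonglongrightarrow> 0) \<longleftrightarrow> (\<lambda>i. norm (J (F i))) \<longlonglongrightarrow> 0)"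
    using quasi_free unfolding quasi_free_module_def by (elim conjE)
  then show ?thesis using assms by metis
qed

lemma disk_tensor_sum:
  fixes x :: "'i \<Rightarrow> 'e::complex_hilbert_space"
  assumes "finite I" "\<And>i. i \<in> I \<Longrightarrow> \<theta> i \<in> disk_algebra"
  shows "(\<lambda>z. \<Sum>i\<in>I. \<theta> i z *\<^sub>C x i) \<in> disk_tensor"
proof -
  obtain h where h: "bij_betw h {0..<card I} I" using ex_bij_betw_nat_finite[OF assms(1)] by blast
  have "\<theta> (h k) \<in> disk_algebra" if "k < card I" for k
    using assms(2) bij_betwE[OF h] that by auto
  moreover have "(\<Sum>i\<in>I. \<theta> i z *\<^sub>C x i) = (\<Sum>k<card I. \<theta> (h k) z *\<^sub>C x (h k))" for z
    using sum.reindex_bij_betw[OF h, of "\<lambda>i. \<theta> i z *\<^sub>C x i"] by (simp add: atLeast0LessThan)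
  ultimately show ?thesis
    unfolding disk_tensor_def
    by (intro CollectI exI[of _ "card I"] exI[of _ "\<lambda>k. \<theta> (h k)"] exI[of _ "\<lambda>k. x (h k)"]) auto
qed

lemma disk_tensor_component:
  fixes F :: "complex \<Rightarrow> complex ^ 'm"
  assumes "F \<in> disk_tensor"
  shows "(\<lambda>z. F z $ i) \<in> disk_algebra"
proof -
  obtain n :: nat and \<theta> x where \<theta>: "\<And>k. k < n \<Longrightarrow> \<theta> k \<in> disk_algebra"
    and F: "F = (\<lambda>z. \<Sum>k<n. \<theta> k z *\<^sub>C x k)"
    using assms unfolding disk_tensor_def by blast
  have "(\<lambda>z. \<Sum>k<n. x k $ i * \<theta> k z) \<in> disk_algebra"
    using \<theta>
  proof (induction n)
    case 0
    have "disk_poly 0 = (\<lambda>z. 0)" by (auto simp: disk_poly_def)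
    then show ?case using disk_poly_in_disk_algebra[of 0] by simp
  next
    case (Suc n)
    then show ?case by (simp add: disk_algebra_add disk_algebra_cmult)
  qed
  then show ?thesis by (simp add: F scaleC_vec_def scaleC_complex_def mult.commute)
qed

lemma vec_eq_sum_axis: "x = (\<Sum>i\<in>UNIV. x $ i *\<^sub>C axis i 1)" for x :: "complex ^ 'm"
  by (simp add: vec_eq_iff scaleC_vec_def scaleC_complex_def axis_def if_distrib cong: if_cong)

definition generator :: "'m \<Rightarrow> 'a" where
  "generator i = J (\<lambda>z. disk_poly 1 z *\<^sub>C axis i 1)"

lemma J_sum_axis:
  assumes "finite I" "\<And>i. i \<in> I \<Longrightarrow> \<theta> i \<in> disk_algebra"
  shows "J (\<lambda>z. \<Sum>i\<in>I. \<theta> i z *\<^sub>C axis i 1) = (\<Sum>i\<in>I. act (\<theta> i) (generator i))"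
  using assms
proof (induction I rule: finite_induct)
  case empty
  have "(\<lambda>z. 0) \<in> disk_tensor" using disk_tensor_sum[of "{}"] by simp
  from J_scaleC[OF this, of 0] show ?case by simp
next
  case (insert i I)
  have const: "(\<lambda>z. disk_poly 1 z *\<^sub>C axis i 1) \<in> disk_tensor"
    using disk_tensor_sum[of "{i}" "\<lambda>_. disk_poly 1"] by (simp add: disk_poly_in_disk_algebra)
  \<comment> \<open>Off the disk \<open>disk_poly 1\<close> vanishes, but there
    \<open>\<theta> i\<close> vanishes too.\<close>
  have "\<theta> i z *\<^sub>C disk_poly 1 z *\<^sub>C axis i 1 = \<theta> i z *\<^sub>C (axis i 1 :: complex ^ 'm)" for z
    using insert.prems[of i] by (cases "z \<in> \<D>") (auto simp: disk_poly_def disk_algebra_def)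
  then have "(\<lambda>z. \<theta> i z *\<^sub>C disk_poly 1 z *\<^sub>C axis i 1) = (\<lambda>z. \<theta> i z *\<^sub>C (axis i 1 :: complex ^ 'm))"
    by (rule ext)
  then have act: "act (\<theta> i) (generator i) = J (\<lambda>z. \<theta> i z *\<^sub>C axis i 1)"
    using act_J[OF insert.prems[of i] const] by (simp only: generator_def insertI1 simp_thms)
  have single: "(\<lambda>z. \<theta> i z *\<^sub>C axis i 1) \<in> disk_tensor"
    using disk_tensor_sum[of "{i}" \<theta>] insert.prems by simp
  have "(\<lambda>z. \<Sum>i\<in>I. \<theta> i z *\<^sub>C axis i 1) \<in> disk_tensor"
    using insert by (intro disk_tensor_sum) auto
  from J_add[OF single this] show ?case using insert by (simp add: act)
qed

lemma J_eq_sum: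
  assumes "F \<in> disk_tensor"
  shows "J F = (\<Sum>i\<in>UNIV. act (\<lambda>z. F z $ i) (generator i))"
  using J_sum_axis[of UNIV "\<lambda>i z. F z $ i"] disk_tensor_component[OF assms]
  by (simp add: vec_eq_sum_axis[symmetric])

section \<open>Polynomial vectors and Taylor coefficient functionals\<close>

definition poly_tensor :: "nat \<Rightarrow> (nat \<Rightarrow> 'm \<Rightarrow> complex) \<Rightarrow> complex \<Rightarrow> complex ^ 'm" where
  "poly_tensor L c z = (\<Sum>i\<in>UNIV. disk_poly (\<Sum>n<L. monom (c n i) n) z *\<^sub>C axis i 1)"

abbreviation poly_vector :: "nat \<Rightarrow> (nat \<Rightarrow> 'm \<Rightarrow> complex) \<Rightarrow> 'a" where
  "poly_vector \<equiv> module_poly shift generator"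

lemma poly_tensor_in_disk_tensor: "poly_tensor L c \<in> disk_tensor"
  unfolding poly_tensor_def[abs_def] by (intro disk_tensor_sum disk_poly_in_disk_algebra) simp

lemma coeff_sum_monom: "coeff (\<Sum>n<L. monom (c n) n) k = (if k < L then c k else 0)"
  by (simp add: coeff_sum)

lemma act_sum_monom:
  "act (disk_poly (\<Sum>n<L. monom (c n) n)) f = (\<Sum>n<L. c n *\<^sub>C (shift ^^ n) f)"
  by (subst act_disk_poly_eq_sum[of L]) (auto simp: coeff_sum_monom intro!: sum.cong)

lemma J_poly_tensor: "J (poly_tensor L c) = poly_vector L c"
  unfolding poly_tensor_def[abs_def] module_poly_def
  by (subst J_sum_axis) (simp_all add: disk_poly_in_disk_algebra act_sum_monom sum.swap[of _ _ UNIV])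

lemma poly_tensor_component:
  "poly_tensor L c z $ i = disk_poly (\<Sum>n<L. monom (c n i) n) z"
  by (simp add: poly_tensor_def scaleC_vec_def scaleC_complex_def axis_def if_distrib cong: if_cong)

text \<open>Each of the finitely many components of a tensor is approximated by a polynomial, with
  errors weighted by the norms of the generators.\<close>

lemma poly_vectors_dense:
  assumes "\<epsilon> > 0"
  shows "\<exists>L c. norm (x - poly_vector L c) < \<epsilon>"
proof -
  obtain F where F: "F \<in> disk_tensor" "norm (x - J F) < \<epsilon> / 2"
  proof -
    have "x \<in> closure (J ` disk_tensor)" using J_dense by simp
    then have "\<exists>y\<in>J ` disk_tensor. dist y x < \<epsilon> / 2"
      using assms unfolding closure_approachable by (meson half_gt_zero)
    then show ?thesis using that by (auto simp: dist_norm norm_minus_commute)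
  qed
  define W where "W = (\<Sum>i\<in>UNIV. norm (generator i)) + 1"
  have W: "W > 0" unfolding W_def by (simp add: add_nonneg_pos sum_nonneg)
  define \<delta> where "\<delta> = \<epsilon> / 2 / W"
  have \<delta>: "\<delta> > 0" using assms W by (simp add: \<delta>_def)
  have "\<exists>p. \<forall>f. norm (act (\<lambda>z. F z $ i) f - act (disk_poly p) f) \<le> \<delta> * norm f" for i
    using act_approx[OF disk_tensor_component[OF F(1)] \<delta>] by metis
  then obtain p where p: "\<And>i f. norm (act (\<lambda>z. F z $ i) f - act (disk_poly (p i)) f) \<le> \<delta> * norm f"
    by metis
  define L where "L = Suc (\<Sum>i\<in>UNIV. degree (p i))"
  have "degree (p i) < L" for i unfolding L_def less_Suc_eq_le by (rule member_le_sum) auto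
  then have "coeff (p i) n = 0" if "n \<ge> L" for i n
    using that by (meson coeff_eq_0 order_less_le_trans)
  then have act_p: "act (disk_poly (p i)) f = (\<Sum>n<L. coeff (p i) n *\<^sub>C (shift ^^ n) f)" for i f
    by (rule act_disk_poly_eq_sum)
  have "norm (J F - poly_vector L (\<lambda>n i. coeff (p i) n))
      = norm (\<Sum>i\<in>UNIV. act (\<lambda>z. F z $ i) (generator i) - act (disk_poly (p i)) (generator i))"
    by (simp add: J_eq_sum[OF F(1)] module_poly_def act_p sum_subtractf sum.swap[of _ _ UNIV])
  also have "\<dots> \<le> (\<Sum>i\<in>UNIV. \<delta> * norm (generator i))"
    by (intro order_trans[OF norm_sum] sum_mono p)
  also have "\<dots> \<le> \<delta> * W"
    using \<delta> by (simp add: W_def sum_distrib_left[symmetric])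
  also have "\<dots> = \<epsilon> / 2" using W by (simp add: \<delta>_def)
  finally have "norm (x - poly_vector L (\<lambda>n i. coeff (p i) n)) < \<epsilon>"
    using norm_triangle_ineq[of "x - J F" "J F - poly_vector L (\<lambda>n i. coeff (p i) n)"] F(2) by simp
  then show ?thesis by blast
qed

text \<open>The local bounds are made uniform by a finite cover of the compact disk of radius
  \<open>\<rho>\<close>.\<close>

lemma uniform_bound:
  assumes "\<rho> < 1"
  obtains C where "C \<ge> 0" "\<And>z F. cmod z \<le> \<rho> \<Longrightarrow> F \<in> disk_tensor \<Longrightarrow> norm (F z) \<le> C * norm (J F)"
proof -
  have "\<forall>z\<in>cball 0 \<rho>. \<exists>r C. r > 0 \<and> (\<forall>w (F :: complex \<Rightarrow> complex ^ 'm). w \<in> ball z r \<inter> \<D> \<longrightarrow> F \<in> disk_tensor \<longrightarrow> norm (F w) \<le> C * norm (J F))"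
  proof
    fix z :: complex assume "z \<in> cball 0 \<rho>"
    then have "z \<in> \<D>" using assms by simp
    then show "\<exists>r C. r > 0 \<and> (\<forall>w (F :: complex \<Rightarrow> complex ^ 'm). w \<in> ball z r \<inter> \<D> \<longrightarrow> F \<in> disk_tensor \<longrightarrow> norm (F w) \<le> C * norm (J F))"
      using local_bound[of z] by metis
  qed
  then obtain r C where r: "\<And>z. z \<in> cball 0 \<rho> \<Longrightarrow> r z > 0"
    and C: "\<And>z w (F :: complex \<Rightarrow> complex ^ 'm). z \<in> cball 0 \<rho> \<Longrightarrow> w \<in> ball z (r z) \<inter> \<D> \<Longrightarrow> F \<in> disk_tensor \<Longrightarrow> norm (F w) \<le> C z * norm (J F)"
    by metis
  obtain Z where Z: "Z \<subseteq> cball 0 \<rho>" "finite Z" "cball 0 \<rho> \<subseteq> (\<Union>z\<in>Z. ball z (r z))"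
    by (rule compactE_image[of "cball (0::complex) \<rho>" "cball 0 \<rho>" "\<lambda>z. ball z (r z)"])
       (use r in auto)
  show ?thesis
  proof (rule that[of "\<Sum>z\<in>Z. \<bar>C z\<bar>"])
    fix w and F :: "complex \<Rightarrow> complex ^ 'm" assume w: "cmod w \<le> \<rho>" and F: "F \<in> disk_tensor"
    then obtain z where z: "z \<in> Z" "w \<in> ball z (r z)" using Z(3) by auto
    have "norm (F w) \<le> C z * norm (J F)"
      using C[of z w F] z w F Z(1) assms by auto
    also have "\<dots> \<le> (\<Sum>z\<in>Z. \<bar>C z\<bar>) * norm (J F)"
      using member_le_sum[OF z(1), of "\<lambda>z. \<bar>C z\<bar>"] Z(2)
      by (intro mult_right_mono) auto
    finally show "norm (F w) \<le> (\<Sum>z\<in>Z. \<bar>C z\<bar>) * norm (J F)" .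
  qed (simp add: sum_nonneg)
qed

text \<open>Cauchy estimates on the circle of radius \<open>\<rho>\<close> convert the bound on
  evaluations into one on coefficients. \<open>C\<close> is independent of \<open>n\<close>, and
  \<open>\<rho>\<close> may be taken close to 1, so the functionals grow subexponentially.\<close>

lemma coefficient_bound:
  assumes "0 < \<rho>" "\<rho> < 1"
  obtains C where "C \<ge> 0" "\<And>L c n i. n < L \<Longrightarrow> cmod (c n i) \<le> C / \<rho> ^ n * norm (poly_vector L c)"
proof -
  obtain C where C: "C \<ge> 0" "\<And>z F. cmod z \<le> \<rho> \<Longrightarrow> F \<in> disk_tensor \<Longrightarrow> norm (F z) \<le> C * norm (J F)"
    using uniform_bound[OF assms(2)] by blast
  have "cmod (c n i) \<le> C / \<rho> ^ n * norm (poly_vector L c)" if n: "n < L" for L c n i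
  proof -
    have "cmod (poly (\<Sum>n<L. monom (c n i) n) z) \<le> C * norm (poly_vector L c)" if z: "cmod z = \<rho>" for z
    proof -
      have "cmod (poly_tensor L c z $ i) \<le> norm (poly_tensor L c z)" by (rule Finite_Cartesian_Product.norm_nth_le)
      also have "\<dots> \<le> C * norm (J (poly_tensor L c))"
        using z by (intro C poly_tensor_in_disk_tensor) simp
      finally show ?thesis
        using z assms by (simp add: poly_tensor_component J_poly_tensor disk_poly_def)
    qed
    then show ?thesis
      using poly_coeff_bound[OF assms(1), of "\<Sum>n<L. monom (c n i) n" "C * norm (poly_vector L c)" n] n
      by (simp add: coeff_sum_monom)
  qed
  then show ?thesis using that C(1) by blast
qed

lemma poly_vector_extend:
  assumes "L \<le> L'" "\<And>k i. k \<ge> L \<Longrightarrow> c k i = 0"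
  shows "poly_vector L' c = poly_vector L c"
  unfolding module_poly_def using assms by (intro sum.mono_neutral_right) auto

lemma coefficient_vector_exists:
  "\<exists>y. \<forall>L c. (\<forall>k\<ge>L. \<forall>i. c k i = 0) \<longrightarrow> cinner (poly_vector L c) y = c n i"
proof -
  obtain C where C: "C \<ge> 0" "\<And>L c n i. n < L \<Longrightarrow> cmod (c n i) \<le> C / (1/2) ^ n * norm (poly_vector L c)"
    using coefficient_bound[of "1/2"] by auto
  \<comment> \<open>A relation, because \<open>v\<close> may a priori have several representations.
    Requiring \<open>c\<close> to vanish from \<open>L\<close> on lets lengths be enlarged to a
    common one when two vectors are added.\<close>
  define R where "R v d \<longleftrightarrow> (\<exists>L c. (\<forall>k\<ge>L. \<forall>i. c k i = 0) \<and> v = poly_vector L c \<and> d = c n i)" for v d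
  obtain y where y: "\<And>v d. R v d \<Longrightarrow> d = cinner v y"
  proof (rule riesz_representation[of R "C / (1/2) ^ n"])
    show "R 0 0" unfolding R_def by (intro exI[of _ 0] exI[of _ "\<lambda>_ _. 0"]) (simp add: module_poly_def)
    show "R (v + w) (d + d')" if Rv: "R v d" and Rw: "R w d'" for v w d d'
    proof -
      obtain L c where c: "\<forall>k\<ge>L. \<forall>i. c k i = 0" "v = poly_vector L c" "d = c n i"
        using Rv unfolding R_def by blast
      obtain L' c' where c': "\<forall>k\<ge>L'. \<forall>i. c' k i = 0" "w = poly_vector L' c'" "d' = c' n i"
        using Rw unfolding R_def by blast
      have "v = poly_vector (max L L') c" "w = poly_vector (max L L') c'"
        using c c' poly_vector_extend[of L "max L L'" c] poly_vector_extend[of L' "max L L'" c']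
        by simp_all
      then have "v + w = poly_vector (max L L') (\<lambda>k i. c k i + c' k i)"
        by (simp add: module_poly_def scaleC_add_left sum.distrib)
      then show ?thesis
        unfolding R_def using c c' by (intro exI[of _ "max L L'"] exI[of _ "\<lambda>k i. c k i + c' k i"]) simp
    qed
    show "R (a *\<^sub>C v) (a * d)" if Rv: "R v d" for a v d
    proof -
      obtain L c where c: "\<forall>k\<ge>L. \<forall>i. c k i = 0" "v = poly_vector L c" "d = c n i"
        using Rv unfolding R_def by blast
      have "a *\<^sub>C v = poly_vector L (\<lambda>k i. a * c k i)"
        by (simp add: c(2) module_poly_def complex_vector.scale_sum_right)
      then show ?thesis
        unfolding R_def using c by (intro exI[of _ L] exI[of _ "\<lambda>k i. a * c k i"]) simp
    qed
    show "cmod d \<le> C / (1/2) ^ n * norm v" if Rv: "R v d" for v d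
    proof -
      obtain L c where c: "\<forall>k\<ge>L. \<forall>i. c k i = 0" "v = poly_vector L c" "d = c n i"
        using Rv unfolding R_def by blast
      show ?thesis
      proof (cases "n < L")
        case True
        then show ?thesis unfolding c(2,3) by (rule C(2))
      next
        case False
        then show ?thesis using c C(1) by simp
      qed
    qed
  qed (use C(1) in auto)
  then show ?thesis unfolding R_def by (intro exI[of _ y]) metis
qed

definition coefficient_vector :: "nat \<Rightarrow> 'm \<Rightarrow> 'a" where
  "coefficient_vector n i =
     (SOME y. \<forall>L c. (\<forall>k\<ge>L. \<forall>i. c k i = 0) \<longrightarrow> cinner (poly_vector L c) y = c n i)"

lemma cinner_poly_vector:
  "cinner (poly_vector L c) (coefficient_vector n i) = (if n < L then c n i else 0)"
proof -
  define c' where "c' k i = (if k < L then c k i else 0)" for k i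
  have "poly_vector L c = poly_vector L c'" by (simp add: module_poly_def c'_def)
  moreover have "\<forall>L c. (\<forall>k\<ge>L. \<forall>i. c k i = 0) \<longrightarrow> cinner (poly_vector L c) (coefficient_vector n i) = c n i"
    unfolding coefficient_vector_def by (rule someI_ex) (rule coefficient_vector_exists)
  then have "cinner (poly_vector L c') (coefficient_vector n i) = c' n i" by (auto simp: c'_def)
  ultimately show ?thesis by (simp add: c'_def)
qed

text \<open>Polynomials converging to the coefficient vector itself carry the coefficient bound over
  to its norm.\<close>

lemma norm_coefficient_vector_le:
  assumes "0 < \<rho>" "\<rho> < 1"
  shows "\<exists>C. \<forall>n i. norm (coefficient_vector n i) \<le> C / \<rho> ^ n"
proof -
  obtain C where C: "C \<ge> 0" "\<And>L c n i. n < L \<Longrightarrow> cmod (c n i) \<le> C / \<rho> ^ n * norm (poly_vector L c)"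
    using coefficient_bound[OF assms] by blast
  have "norm (coefficient_vector n i) \<le> C / \<rho> ^ n" for n i
  proof -
    let ?\<kappa> = "coefficient_vector n i"
    obtain L c where lim: "(\<lambda>k. poly_vector (L k) (c k)) \<longlonglongrightarrow> ?\<kappa>" by (rule module_poly_tendsto[OF poly_vectors_dense])
    have "cmod (cinner (poly_vector (L k) (c k)) ?\<kappa>) \<le> C / \<rho> ^ n * norm (poly_vector (L k) (c k))" for k
      using C assms(1) by (simp add: cinner_poly_vector)
    then have "cmod (cinner ?\<kappa> ?\<kappa>) \<le> C / \<rho> ^ n * norm ?\<kappa>"
      by (intro tendsto_le[OF _ tendsto_mult[OF tendsto_const tendsto_norm[OF lim]]
            tendsto_norm[OF tendsto_cinner_left[OF lim]]]) auto
    then have "norm ?\<kappa> * norm ?\<kappa> \<le> C / \<rho> ^ n * norm ?\<kappa>"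
      by (simp add: cinner_self power2_eq_square norm_mult)
    then have "norm ?\<kappa> \<le> C / \<rho> ^ n" if "?\<kappa> \<noteq> 0"
      using that by (intro mult_right_le_imp_le[of "norm ?\<kappa>" "norm ?\<kappa>"]) auto
    then show ?thesis using C(1) assms(1) by (cases "?\<kappa> = 0") auto
  qed
  then show ?thesis by blast
qed

text \<open>This is where condition (3) in the definition of quasi-freeness enters.\<close>

lemma coefficient_vectors_determine:
  assumes x: "\<And>n i. cinner x (coefficient_vector n i) = 0"
  shows "x = 0"
proof -
  obtain L c where lim: "(\<lambda>k. poly_vector (L k) (c k)) \<longlonglongrightarrow> x" by (rule module_poly_tendsto[OF poly_vectors_dense])
  have "(\<lambda>k. norm (J (poly_tensor (L k) (c k)))) \<longlonglongrightarrow> 0"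
  proof (rule J_null)
    show "Cauchy (\<lambda>k. J (poly_tensor (L k) (c k)))"
      unfolding J_poly_tensor using lim by (rule LIMSEQ_imp_Cauchy)
    fix z :: complex assume z: "z \<in> \<D>"
    \<comment> \<open>The gap between \<open>cmod z\<close> and \<open>\<rho>\<close> makes the
      series of coefficient bounds at \<open>z\<close> geometric.\<close>
    obtain \<rho> where \<rho>: "cmod z < \<rho>" "\<rho> < 1" using z dense[of "cmod z" 1] by auto
    have \<rho>0: "\<rho> > 0" using \<rho>(1) norm_ge_zero[of z] by linarith
    obtain C where C: "\<And>n i. norm (coefficient_vector n i) \<le> C / \<rho> ^ n"
      using norm_coefficient_vector_le[OF \<rho>0 \<rho>(2)] by blast
    define K where "K = C * (1 / (1 - cmod z / \<rho>))"
    \<comment> \<open>\<open>undefined\<close> stands for an arbitrary index in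
      \<open>'m\<close>.\<close>
    have C0: "C \<ge> 0" using order_trans[OF norm_ge_zero C[of 0 undefined]] by simp
    have bound: "cmod (poly_tensor (L k) (c k) z $ i) \<le> norm (poly_vector (L k) (c k) - x) * K" for k i
    proof -
      define d where "d = norm (poly_vector (L k) (c k) - x)"
      have coeff: "cmod (c k n i) \<le> d * (C / \<rho> ^ n)" if n: "n < L k" for n
      proof -
        \<comment> \<open>All coefficients of \<open>x\<close> vanish, so \<open>c k n i\<close> is
          a coefficient of the difference from \<open>x\<close> and is controlled by its
          norm.\<close>
        have "c k n i = cinner (poly_vector (L k) (c k) - x) (coefficient_vector n i)"
          using n by (simp add: cinner_diff_left cinner_poly_vector x)
        then have "cmod (c k n i) \<le> d * norm (coefficient_vector n i)"
          unfolding d_def by (simp add: norm_cinner_le)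
        also have "\<dots> \<le> d * (C / \<rho> ^ n)"
          using C by (intro mult_left_mono) (auto simp: d_def)
        finally show ?thesis .
      qed
      have "poly_tensor (L k) (c k) z $ i = (\<Sum>n<L k. c k n i * z ^ n)"
        using z by (simp add: poly_tensor_component disk_poly_def poly_sum poly_monom)
      also have "cmod \<dots> \<le> (\<Sum>n<L k. d * C * (cmod z / \<rho>) ^ n)"
      proof (intro order_trans[OF norm_sum] sum_mono)
        fix n assume "n \<in> {..<L k}"
        then have "cmod (c k n i) * cmod z ^ n \<le> d * (C / \<rho> ^ n) * cmod z ^ n"
          by (intro mult_right_mono coeff) auto
        then show "norm (c k n i * z ^ n) \<le> d * C * (cmod z / \<rho>) ^ n"
          by (simp add: norm_mult norm_power power_divide)
      qed
      also have "\<dots> \<le> (\<Sum>n. d * C * (cmod z / \<rho>) ^ n)"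
        using \<rho> \<rho>0 C0 by (intro sum_le_suminf summable_mult summable_geometric) (auto simp: d_def)
      also have "\<dots> = d * K"
        using \<rho> \<rho>0 by (simp add: K_def suminf_mult summable_geometric suminf_geometric)
      finally show ?thesis unfolding d_def .
    qed
    have "(\<lambda>k. norm (poly_vector (L k) (c k) - x) * K) \<longlonglongrightarrow> 0"
      using lim by (intro tendsto_mult_left_zero tendsto_norm_zero) (simp add: LIM_zero)
    then have "(\<lambda>k. poly_tensor (L k) (c k) z $ i) \<longlonglongrightarrow> 0" for i
      by (rule Lim_null_comparison[rotated]) (use bound in auto)
    then show "(\<lambda>k. poly_tensor (L k) (c k) z) \<longlonglongrightarrow> 0"
      by (intro vec_tendstoI) simp
  qed (rule poly_tensor_in_disk_tensor)
  then have "(\<lambda>k. poly_vector (L k) (c k)) \<longlonglongrightarrow> 0"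
    unfolding J_poly_tensor by (rule tendsto_norm_zero_cancel)
  then show ?thesis using lim LIMSEQ_unique by blast
qed

text \<open>Riesz representation supplies an adjoint, so the choice in \<open>cadjoint\<close>
  really yields one.\<close>

sublocale contraction_pair shift "cadjoint shift"
proof (rule contraction_pair.intro)
  obtain S where "\<And>x y. cinner (shift x) y = cinner x (S y)"
    by (rule adjoint_exists[OF shift_contraction(1), of 1]) (use shift_contraction(2) in auto)
  then have "\<forall>x y. cinner (shift x) y = cinner x (cadjoint shift y)"
    unfolding cadjoint_def by (intro someI_ex[of "\<lambda>S. \<forall>x y. cinner (shift x) y = cinner x (S y)"]) blast
  then show "cinner (shift x) y = cinner x (cadjoint shift y)" for x y by blast
qed (rule shift_contraction)+

sublocale taylor_module shift "cadjoint shift" generator coefficient_vector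
proof
  show "\<exists>L c. norm (x - poly_vector L c) < \<epsilon>" if "\<epsilon> > 0" for x \<epsilon>
    using poly_vectors_dense[OF that] .
  show "cinner ((shift ^^ n) (generator i)) (coefficient_vector l j) = (if n = l \<and> i = j then 1 else 0)" for n i l j
  proof -
    let ?c = "\<lambda>k j. if k = n \<and> j = i then 1 else 0"
    have "poly_vector (Suc n) ?c = (\<Sum>k<Suc n. if k = n then (shift ^^ n) (generator i) else 0)"
      unfolding module_poly_def
    proof (rule sum.cong[OF refl])
      fix k
      have "(\<Sum>j\<in>UNIV. ?c k j *\<^sub>C (shift ^^ k) (generator j))
          = (\<Sum>j\<in>UNIV. if j = i then (if k = n then (shift ^^ n) (generator i) else 0) else 0)"
        by (intro sum.cong) auto
      then show "(\<Sum>j\<in>UNIV. ?c k j *\<^sub>C (shift ^^ k) (generator j)) = (if k = n then (shift ^^ n) (generator i) else 0)"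
        by simp
    qed
    then have "(shift ^^ n) (generator i) = poly_vector (Suc n) ?c" by simp
    then show ?thesis by (auto simp: cinner_poly_vector)
  qed
  show "\<exists>C. \<forall>n i. norm (coefficient_vector n i) \<le> C / \<rho> ^ n" if "0 < \<rho>" "\<rho> < 1" for \<rho>
    using norm_coefficient_vector_le[OF that] .
  show "x = 0" if "\<And>n i. cinner x (coefficient_vector n i) = 0" for x
    using coefficient_vectors_determine[OF that] .
qed

end

text \<open>The intertwining relation for the shift extends to polynomials by Horner's recursion,
  then to \<open>\<phi>\<close> by operator norm approximation and continuity of the point
  evaluations of \<open>wold_map\<close>.\<close>

lemma (in hilbert_disk_module) wold_map_act:
  assumes "pure_isometry shift S" and \<phi>: "\<phi> \<in> disk_algebra"
  shows "pure_isometry.wold_map shift S (act \<phi> f) = (\<lambda>z. \<phi> z *\<^sub>C pure_isometry.wold_map shift S f z)"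
proof -
  interpret pure_isometry shift S by fact
  have poly: "wold_map (act (disk_poly p) f) = (\<lambda>z. poly p z *\<^sub>C wold_map f z)" for p
  proof (induction p)
    case 0
    have "act (disk_poly 0) f = 0" by (subst act_disk_poly_eq_sum[of 0]) auto
    then show ?case using wold_map_scaleC[of 0 f] by simp
  next
    case (pCons a p)
    then show ?case
      by (simp add: act_pCons wold_map_add wold_map_scaleC wold_map_shift scaleC_scaleC scaleC_add_left)
  qed
  show ?thesis
  proof (rule wold_map_eqI)
    fix z assume z: "z \<in> \<D>"
    have pos: "1 - cmod z > 0" using z by simp
    define K where "K = norm f / (1 - cmod z) + norm (wold_map f z)"
    have "norm (wold_map (act \<phi> f) z - \<phi> z *\<^sub>C wold_map f z) \<le> \<epsilon> * K" if \<epsilon>: "\<epsilon> > 0" for \<epsilon>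
    proof -
      obtain p where p: "\<And>z. z \<in> \<D> \<Longrightarrow> cmod (\<phi> z - disk_poly p z) < \<epsilon>"
        "\<And>f. norm (act \<phi> f - act (disk_poly p) f) \<le> \<epsilon> * norm f"
        using act_approx[OF \<phi> \<epsilon>] by blast
      let ?g = "act \<phi> f - act (disk_poly p) f"
      have "wold_map (act \<phi> f) z = wold_map ?g z + poly p z *\<^sub>C wold_map f z"
        using wold_map_add[of ?g "act (disk_poly p) f"] by (simp add: poly)
      then have "wold_map (act \<phi> f) z - \<phi> z *\<^sub>C wold_map f z
          = wold_map ?g z - (\<phi> z - poly p z) *\<^sub>C wold_map f z"
        by (simp add: complex_vector.scale_left_diff_distrib)
      also have "norm \<dots> \<le> norm (wold_map ?g z) + norm ((\<phi> z - poly p z) *\<^sub>C wold_map f z)"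
        by (rule norm_triangle_ineq4)
      also have "\<dots> \<le> \<epsilon> * norm f / (1 - cmod z) + \<epsilon> * norm (wold_map f z)"
      proof (rule add_mono)
        show "norm (wold_map ?g z) \<le> \<epsilon> * norm f / (1 - cmod z)"
          using wold_map_sums(2)[OF z, of ?g] divide_right_mono[OF p(2)[of f], of "1 - cmod z"] pos by simp
        show "norm ((\<phi> z - poly p z) *\<^sub>C wold_map f z) \<le> \<epsilon> * norm (wold_map f z)"
          using p(1)[OF z] z by (simp add: disk_poly_def mult_right_mono)
      qed
      finally show ?thesis by (simp add: K_def distrib_left)
    qed
    moreover have "K \<ge> 0" using pos by (simp add: K_def)
    ultimately have "norm (wold_map (act \<phi> f) z - \<phi> z *\<^sub>C wold_map f z) \<le> 0"
    proof -
      have "norm (wold_map (act \<phi> f) z - \<phi> z *\<^sub>C wold_map f z) \<le> 0 + \<epsilon>" if "\<epsilon> > 0" for \<epsilon>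
      proof -
        have "\<epsilon> / (K + 1) * K \<le> \<epsilon>" using \<open>K \<ge> 0\<close> that by (simp add: field_simps)
        moreover have "\<epsilon> / (K + 1) > 0" using \<open>K \<ge> 0\<close> that by simp
        ultimately show ?thesis
          using \<open>\<And>\<epsilon>. \<epsilon> > 0 \<Longrightarrow> norm (wold_map (act \<phi> f) z - \<phi> z *\<^sub>C wold_map f z) \<le> \<epsilon> * K\<close>[of "\<epsilon> / (K + 1)"]
          by linarith
      qed
      then show ?thesis by (rule field_le_epsilon)
    qed
    then show "wold_map (act \<phi> f) z = \<phi> z *\<^sub>C wold_map f z" by simp
  qed (use \<phi> in \<open>auto simp: wold_map_def disk_algebra_def\<close>)
qed

theorem theorem5:
  fixes act :: "(complex \<Rightarrow> complex) \<Rightarrow> 'a \<Rightarrow> 'a::{complex_hilbert_space, second_countable_topology}"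
    and J :: "(complex \<Rightarrow> complex ^ 'm) \<Rightarrow> 'a"
    and U :: "'a \<Rightarrow> 'a"
  assumes "quasi_free_module act J"
    and "essentially_reductive act"
    and "module_map act act U"
    and "\<And>f. norm (U f) = norm f"
    and "(\<Inter>k::nat. range (U ^^ k)) = {0}"
  shows "\<exists>F :: 'a set. csubspace F \<and> closed F \<and> cdim F = CARD('m) \<and>
           unitarily_equivalent_hardy act F"
proof -
  interpret quasi_free act J by (rule quasi_free.intro) (rule assms(1))
  obtain U' where U': "\<And>x y. cinner (U x) y = cinner x (U' y)"
    by (rule adjoint_exists[of U 1]) (use assms(3,4) in \<open>auto simp: module_map_def\<close>)
  interpret U: pure_isometry U U'
    using assms(3-5) U'
    by (intro pure_isometry.intro contraction_pair.intro pure_isometry_axioms.intro)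
       (auto simp: module_map_def)
  \<comment> \<open>This interpretation makes \<open>shift\<close> a pure isometry; its Wold map is
    the required unitary, with the kernel of the adjoint shift as coefficient space.\<close>
  interpret essentially_normal_taylor_module shift "cadjoint shift" U U' generator coefficient_vector
  proof
    show "shift (U x) = U (shift x)" for x
      using assms(3) disk_poly_in_disk_algebra unfolding module_map_def shift_def by simp
    show "compact_operator (\<lambda>x. cadjoint shift (shift x) - shift (cadjoint shift x))"
      using assms(2) disk_poly_in_disk_algebra unfolding essentially_reductive_def shift_def by blast
  qed
  have "unitarily_equivalent_hardy act {x. cadjoint shift x = 0}"
    unfolding unitarily_equivalent_hardy_def
  proof (intro exI[of _ wold_map] conjI allI ballI)
    show "wold_map (act \<phi> f) = (\<lambda>z. \<phi> z *\<^sub>C wold_map f z)" if "\<phi> \<in> disk_algebra" for \<phi> f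
      by (rule wold_map_act[OF pure_isometry_axioms that])
  qed (simp_all add: wold_map_add wold_map_scaleC range_wold_map hardy_inner_wold_map)
  then show ?thesis
    using csubspace_kernel_adjoint closed_kernel_adjoint cdim_kernel_adjoint by blast
qed

end
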